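(* For every $\tau\in\mathbb{C}$ with $\operatorname{Im}\tau>0$, there is an origami embedding in the 3-dimensional Euclidean space $\mathbb{R}^3$ of a 2-dimensional flat torus of modulus $\tau$.
   Context: A 2-dimensional flat torus is a quotient $\mathbb{C}/\Lambda$ of the Euclidean plane by a lattice $\Lambda$, with the induced flat metric. It has modulus $\tau$ ($\operatorname{Im}\tau>0$) if it is similar (isometric up to a constant scaling factor) to $\mathbb{C}/(\mathbb{Z}+\tau\mathbb{Z})$. The number $\tau$ is determined only up to the usual change of oriented basis of the lattice; a fundamental domain for the moduli is $\{z\in\mathbb{C} : |\operatorname{Re} z|\le \tfrac12,\ |z|\ge 1\}$ (with $\operatorname{Im} z>0$). An origami embedding of a flat torus $T$ in $\mathbb{R}^3$ is an injective continuous map $f:T\to\mathbb{R}^3$ that is piecewise linear and isometric: $T$ has a finite triangulation into flat (geodesic) triangles such that $f$ maps each triangle isometrically onto a Euclidean triangle in $\mathbb{R}^3$. *)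

theory Defs
  imports "HOL-Analysis.Analysis"
begin

section \<open>Lattices and flat tori\<close>

definition lattice_gen :: "complex \<Rightarrow> complex \<Rightarrow> complex set" where
  "lattice_gen w1 w2 = {of_int m * w1 + of_int n * w2 | m n. True}"

definition is_lattice :: "complex set \<Rightarrow> bool" where
  "is_lattice \<Lambda> \<longleftrightarrow>
     (\<exists>w1 w2. w1 \<noteq> w2 \<and> independent {w1, w2} \<and> \<Lambda> = lattice_gen w1 w2)"

definition torus_proj :: "complex set \<Rightarrow> complex \<Rightarrow> complex set" where
  "torus_proj \<Lambda> z = (+) z ` \<Lambda>"

text \<open>
  Points of the torus are cosets of the lattice.  The lattice acts by translations, so the
  metric induced on the quotient is the infimum of the Euclidean distances between
  representatives, i.e. the library's \<open>setdist\<close> of the two cosets.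
\<close>

definition flat_torus :: "complex set \<Rightarrow> complex set set" where
  "flat_torus \<Lambda> = range (torus_proj \<Lambda>)"

abbreviation torus_topology :: "complex set \<Rightarrow> complex set topology" where
  "torus_topology \<Lambda> \<equiv> Metric_space.mtopology (flat_torus \<Lambda>) setdist"

text \<open>
  Similarities are taken in the metric sense and may reverse the orientation.
\<close>

definition has_modulus :: "complex set \<Rightarrow> complex \<Rightarrow> bool" where
  "has_modulus \<Lambda> \<tau> \<longleftrightarrow>
     Im \<tau> > 0 \<and>
     (\<exists>g c. c > 0 \<and> bij_betw g (flat_torus \<Lambda>) (flat_torus (lattice_gen 1 \<tau>)) \<and>
        (\<forall>X\<in>flat_torus \<Lambda>. \<forall>Y\<in>flat_torus \<Lambda>. setdist (g X) (g Y) = c * setdist X Y))"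

section \<open>Origami embeddings\<close>

text \<open>
  A geodesic triangle of the torus is represented by a lift: a nondegenerate closed triangle
  in the plane on which the projection is injective.  The lift is unique up to translation by
  the lattice.  Distinct triangles meet in the torus in a common face (possibly empty).
\<close>

definition torus_triangulation :: "complex set \<Rightarrow> complex set set \<Rightarrow> bool" where
  "torus_triangulation \<Lambda> K \<longleftrightarrow>
     finite K \<and>
     (\<forall>P\<in>K. 2 simplex P \<and> inj_on (torus_proj \<Lambda>) P) \<and>
     (\<Union>P\<in>K. torus_proj \<Lambda> ` P) = flat_torus \<Lambda> \<and>
     (\<forall>P\<in>K. \<forall>Q\<in>K. P \<noteq> Q \<longrightarrow>
        (\<exists>F G. F face_of P \<and> G face_of Q \<and>
           torus_proj \<Lambda> ` P \<inter> torus_proj \<Lambda> ` Q = torus_proj \<Lambda> ` F \<and>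
           torus_proj \<Lambda> ` F = torus_proj \<Lambda> ` G))"

text \<open>
  The metric on a triangle of the torus is its intrinsic one, which is the Euclidean metric of
  the lift; the distance in the torus between two of its points may be smaller.
\<close>

definition isometric_on_triangle ::
    "complex set \<Rightarrow> (complex set \<Rightarrow> real^3) \<Rightarrow> complex set \<Rightarrow> bool" where
  "isometric_on_triangle \<Lambda> f P \<longleftrightarrow>
     2 simplex (f ` torus_proj \<Lambda> ` P) \<and>
     (\<forall>x\<in>P. \<forall>y\<in>P. dist (f (torus_proj \<Lambda> x)) (f (torus_proj \<Lambda> y)) = dist x y)"

definition origami_embedding :: "complex set \<Rightarrow> (complex set \<Rightarrow> real^3) \<Rightarrow> bool" where
  "origami_embedding \<Lambda> f \<longleftrightarrow>
     inj_on f (flat_torus \<Lambda>) \<and>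
     continuous_map (torus_topology \<Lambda>) euclidean f \<and>
     (\<exists>K. torus_triangulation \<Lambda> K \<and> (\<forall>P\<in>K. isometric_on_triangle \<Lambda> f P))"

section \<open>The flat torus is a metric space\<close>

lemma lattice_gen_zero: "0 \<in> lattice_gen w1 w2"
  unfolding lattice_gen_def by (auto intro!: exI[of _ 0])

lemma lattice_gen_diff:
  assumes "u \<in> lattice_gen w1 w2" "v \<in> lattice_gen w1 w2"
  shows "u - v \<in> lattice_gen w1 w2"
proof -
  obtain m n m' n' :: int where
    "u = of_int m * w1 + of_int n * w2" "v = of_int m' * w1 + of_int n' * w2"
    using assms unfolding lattice_gen_def by blast
  then have "u - v = of_int (m - m') * w1 + of_int (n - n') * w2"
    by (simp add: algebra_simps)
  then show ?thesis unfolding lattice_gen_def by blast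
qed

lemma lattice_zero: "is_lattice \<Lambda> \<Longrightarrow> 0 \<in> \<Lambda>"
  and lattice_diff: "is_lattice \<Lambda> \<Longrightarrow> u \<in> \<Lambda> \<Longrightarrow> v \<in> \<Lambda> \<Longrightarrow> u - v \<in> \<Lambda>"
  unfolding is_lattice_def using lattice_gen_zero lattice_gen_diff by blast+

lemma lattice_add:
  assumes "is_lattice \<Lambda>" "u \<in> \<Lambda>" "v \<in> \<Lambda>"
  shows "u + v \<in> \<Lambda>"
  using lattice_diff[OF assms(1,2), of "0 - v"] lattice_diff[OF assms(1) lattice_zero assms(3)] assms(1)
  by simp

lemma closed_lattice:
  assumes "is_lattice \<Lambda>"
  shows "closed \<Lambda>"
proof -
  obtain w1 w2 where w: "w1 \<noteq> w2" "independent {w1, w2}" "\<Lambda> = lattice_gen w1 w2"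
    using assms unfolding is_lattice_def by blast
  define h :: "real \<times> real \<Rightarrow> complex" where "h = (\<lambda>(a, b). a *\<^sub>R w1 + b *\<^sub>R w2)"
  have lin: "linear h"
    by (rule linearI) (auto simp: h_def algebra_simps)
  have "a = 0 \<and> b = 0" if "a *\<^sub>R w1 + b *\<^sub>R w2 = 0" for a b :: real
  proof -
    let ?u = "\<lambda>v. if v = w1 then a else b"
    have "(\<Sum>v\<in>{w1, w2}. ?u v *\<^sub>R v) = 0"
      using that w(1) by simp
    then have "\<forall>v\<in>{w1, w2}. ?u v = 0"
      using independentD[OF w(2), of "{w1, w2}" ?u] by auto
    then show ?thesis using w(1) by auto
  qed
  then have inj: "inj h"
    unfolding linear_injective_0[OF lin] by (auto simp: h_def zero_prod_def)
  have "\<Lambda> = h ` (\<int> \<times> \<int>)"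
    unfolding w(3) lattice_gen_def h_def
    by (force simp: scaleR_conv_of_real Ints_def image_iff)
  moreover have "closed (\<int> \<times> \<int> :: (real \<times> real) set)"
    by (intro closed_Times closed_of_int_image[of UNIV, folded Ints_def])
  ultimately show ?thesis
    using closed_injective_linear_image[OF _ lin inj] by simp
qed

lemma torus_proj_eq_iff:
  assumes "is_lattice \<Lambda>"
  shows "torus_proj \<Lambda> x = torus_proj \<Lambda> y \<longleftrightarrow> x - y \<in> \<Lambda>"
proof
  assume "torus_proj \<Lambda> x = torus_proj \<Lambda> y"
  moreover have "x \<in> torus_proj \<Lambda> x"
    using lattice_zero[OF assms] by (force simp: torus_proj_def)
  ultimately have "x \<in> torus_proj \<Lambda> y" by simp
  then show "x - y \<in> \<Lambda>" by (auto simp: torus_proj_def)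
next
  assume xy: "x - y \<in> \<Lambda>"
  then have yx: "y - x \<in> \<Lambda>"
    using lattice_diff[OF assms lattice_zero[OF assms] xy] by simp
  have *: "torus_proj \<Lambda> a \<subseteq> torus_proj \<Lambda> b" if "a - b \<in> \<Lambda>" for a b
    using lattice_add[OF assms that] by (force simp: torus_proj_def image_iff algebra_simps)
  show "torus_proj \<Lambda> x = torus_proj \<Lambda> y"
    using *[OF xy] *[OF yx] by blast
qed

lemma setdist_torus_proj:
  assumes "is_lattice \<Lambda>"
  shows "setdist (torus_proj \<Lambda> x) (torus_proj \<Lambda> y) = setdist {x} (torus_proj \<Lambda> y)"
proof (rule antisym)
  have x: "x \<in> torus_proj \<Lambda> x"
    using lattice_zero[OF assms] by (force simp: torus_proj_def)
  then show "setdist (torus_proj \<Lambda> x) (torus_proj \<Lambda> y) \<le> setdist {x} (torus_proj \<Lambda> y)"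
    by (rule setdist_le_sing)
  show "setdist {x} (torus_proj \<Lambda> y) \<le> setdist (torus_proj \<Lambda> x) (torus_proj \<Lambda> y)"
  proof (rule le_setdistI)
    show "torus_proj \<Lambda> x \<noteq> {}" "torus_proj \<Lambda> y \<noteq> {}"
      using lattice_zero[OF assms] by (auto simp: torus_proj_def)
    fix a b assume "a \<in> torus_proj \<Lambda> x" "b \<in> torus_proj \<Lambda> y"
    then obtain l m where lm: "l \<in> \<Lambda>" "m \<in> \<Lambda>" "a = x + l" "b = y + m"
      by (auto simp: torus_proj_def)
    then have "setdist {x} (torus_proj \<Lambda> y) \<le> dist x (y + (m - l))"
      using lattice_diff[OF assms] by (intro setdist_le_dist) (auto simp: torus_proj_def)
    also have "\<dots> = dist a b"
      using lm by (simp add: dist_norm algebra_simps)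
    finally show "setdist {x} (torus_proj \<Lambda> y) \<le> dist a b" .
  qed
qed

lemma Metric_space_flat_torus:
  assumes "is_lattice \<Lambda>"
  shows "Metric_space (flat_torus \<Lambda>) setdist"
proof
  fix X Y :: "complex set"
  show "0 \<le> setdist X Y" by simp
  show "setdist X Y = setdist Y X" by (rule setdist_sym)
next
  fix X Y assume "X \<in> flat_torus \<Lambda>" "Y \<in> flat_torus \<Lambda>"
  then obtain x y where xy: "X = torus_proj \<Lambda> x" "Y = torus_proj \<Lambda> y"
    by (auto simp: flat_torus_def)
  have "closed Y" "Y \<noteq> {}"
    using closed_lattice[OF assms] lattice_zero[OF assms]
    by (auto simp: xy torus_proj_def closed_translation)
  then have "setdist X Y = 0 \<longleftrightarrow> x \<in> Y"
    by (simp add: xy setdist_torus_proj[OF assms] setdist_eq_0_closed)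
  also have "\<dots> \<longleftrightarrow> x - y \<in> \<Lambda>"
    by (force simp: xy torus_proj_def image_iff)
  finally show "setdist X Y = 0 \<longleftrightarrow> X = Y"
    by (simp add: xy torus_proj_eq_iff[OF assms])
next
  fix X Y Z assume "X \<in> flat_torus \<Lambda>" "Y \<in> flat_torus \<Lambda>" "Z \<in> flat_torus \<Lambda>"
  then obtain x y z where xyz: "X = torus_proj \<Lambda> x" "Y = torus_proj \<Lambda> y" "Z = torus_proj \<Lambda> z"
    by (auto simp: flat_torus_def)
  have "setdist X Z \<le> setdist X {y} + setdist {y} Z"
    by (rule setdist_triangle)
  also have "\<dots> = setdist X Y + setdist Y Z"
    unfolding xyz setdist_torus_proj[OF assms, of y]
    using setdist_torus_proj[OF assms, of y x] by (metis setdist_sym)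
  finally show "setdist X Z \<le> setdist X Y + setdist Y Z" .
qed

end

theory Submission
  imports Defs
begin

text \<open>
The tori are built from bands. Let \<open>\<mu> = \<pi> / n\<close> and take regular \<open>n\<close>-gons inscribed in horizontal unit
circles with their centres on one vertical axis. A band of angle \<open>\<theta>\<close> joins two such polygons by \<open>2n\<close>
triangles, as in a twisted antiprism: every edge of one polygon is joined to the vertex of the other
that is turned by \<open>\<theta>\<close> from the midpoint of the edge, and vice versa with \<open>-\<theta>\<close>. All triangles over one polygon are
congruent, so intrinsically the band is a flat cylinder with geodesic boundaries. Its circumference is
\<open>2 n sin \<mu>\<close>, its height is \<open>sqrt (k\<^sup>2 + (cos \<mu> - cos \<theta>)\<^sup>2)\<close> where \<open>k\<close> is the height of the band in space,
and the two boundaries are offset by \<open>sin \<mu> + sin \<theta>\<close>. The offset is not the arc through which the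
band turns in space, and this discrepancy makes the twist of the torus adjustable.

A cyclic sequence of bands closes up to a flat torus whose lattice is read off from these data. Five
bands are used: on the outside, from bottom to top, a tall prism, two low bands of the same angle
\<open>\<phi>\<close>, and a tall prism; on the inside, one band of angle \<open>\<theta> > \<bar>\<phi>\<bar>\<close> that runs from the top back to the
bottom. A single band is embedded (\<open>slice_inj\<close>). The inner band does not meet the others: within a prism it
stays strictly on the inner side of the planes of all faces, and near the middle its slices lie in a disc
around the axis that is smaller than the hole left free by the two low bands. This is
\<open>five_band_torus\<close>.

The closing condition makes \<open>2 \<phi> + \<theta>\<close> an odd multiple \<open>q\<close> of \<open>\<mu>\<close>. For \<open>n = 36\<close> and four choices of \<open>q\<close>
the intermediate value theorem in \<open>\<phi>\<close> gives every twist between \<open>0\<close> and half the circumference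
\<open>c\<close> (\<open>twists_exhaust\<close>). With the angles fixed, the height of the torus takes all values above the limit in which
everything is flattened into a plane, and this limit is below \<open>c * sqrt 3 / 2\<close>. By lattice reduction
(\<open>reduced_basis\<close>) every lattice is similar, up to a reflection, to one of those obtained.

That the piecewise linear map is well defined, injective and compatible with a triangulation is separated
from the geometry. On a stack of strips of triangles the interpolation of vertex values is given by a closed
formula (\<open>strip_map\<close>), for values in any real vector space. With values in space it is the origami
map; with real values it gives the hat functions of the triangulation, from which the intersection
condition for triangles follows (\<open>origami_embedding_of_PL_map\<close>).
\<close>

section \<open>Piecewise linear maps of a flat torus\<close>

text \<open>
The polarisation identity behind the side-side-side theorem: an affine relation among points is
measured by their mutual distances alone. Maps that are affine on a simplex and preserve the lengths of its
edges are therefore isometries on it.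
\<close>

lemma norm_sum_zero_weights:
  fixes h :: "'a \<Rightarrow> 'b::real_inner"
  assumes "finite V" "sum m V = 0"
  shows "(norm (\<Sum>v\<in>V. m v *\<^sub>R h v))\<^sup>2 = - (\<Sum>v\<in>V. \<Sum>w\<in>V. m v * m w * (dist (h v) (h w))\<^sup>2) / 2"
proof -
  have d: "(dist (h v) (h w))\<^sup>2 = h v \<bullet> h v + h w \<bullet> h w - 2 * (h v \<bullet> h w)" for v w
    by (simp add: dist_norm power2_norm_eq_inner inner_diff inner_commute)
  have "(\<Sum>v\<in>V. \<Sum>w\<in>V. m v * m w * (dist (h v) (h w))\<^sup>2)
      = (\<Sum>v\<in>V. \<Sum>w\<in>V. (m v * (h v \<bullet> h v)) * m w) + (\<Sum>v\<in>V. \<Sum>w\<in>V. m v * (m w * (h w \<bullet> h w)))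
        - 2 * (\<Sum>v\<in>V. \<Sum>w\<in>V. m v * m w * (h v \<bullet> h w))"
    by (simp add: d algebra_simps sum.distrib sum_subtractf sum_distrib_left)
  also have "(\<Sum>v\<in>V. \<Sum>w\<in>V. (m v * (h v \<bullet> h v)) * m w) = 0"
    by (simp add: sum_distrib_left[symmetric] assms)
  also have "(\<Sum>v\<in>V. \<Sum>w\<in>V. m v * (m w * (h w \<bullet> h w))) = sum m V * (\<Sum>w\<in>V. m w * (h w \<bullet> h w))"
    by (simp add: sum_product)
  also have "(\<Sum>v\<in>V. \<Sum>w\<in>V. m v * m w * (h v \<bullet> h w)) = (norm (\<Sum>v\<in>V. m v *\<^sub>R h v))\<^sup>2"
    by (simp add: power2_norm_eq_inner inner_sum_left inner_sum_right sum_distrib_left mult.assoc)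
      (simp add: inner_commute)
  finally show ?thesis by (simp add: assms)
qed

lemma torus_proj_self: "is_lattice \<Lambda> \<Longrightarrow> z \<in> torus_proj \<Lambda> z"
  using lattice_zero by (force simp: torus_proj_def)

text \<open>
\<open>K\<close> is a set of vertex sets of simplices; \<open>G\<close> has to be affine on each simplex, with
prescribed values at the vertices.
\<close>

definition interpolates ::
    "complex set set \<Rightarrow> (complex \<Rightarrow> 'e::real_vector) \<Rightarrow> (complex \<Rightarrow> 'e) \<Rightarrow> bool" where
  "interpolates K G val \<longleftrightarrow> (\<forall>V\<in>K. \<forall>u. (\<forall>v\<in>V. 0 \<le> u v) \<and> sum u V = 1 \<longrightarrow>
     G (\<Sum>v\<in>V. u v *\<^sub>R v) = (\<Sum>v\<in>V. u v *\<^sub>R val v))"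

text \<open>
Well-definedness on the torus and injectivity are the single equivalence for \<open>F x = F y\<close>. That
triangles of the torus meet in common faces is a consequence of the hat functions: if a point lies in two
triangles, then the hat function of each vertex that carries it in one triangle is positive there, so that
vertex also belongs to the other triangle. Continuity holds because the graph of \<open>F\<close> is a finite union of
translated compact graphs, hence closed, and \<open>F\<close> has a compact range.
\<close>

theorem origami_embedding_of_PL_map:
  fixes F :: "complex \<Rightarrow> real^3"
  assumes L: "is_lattice \<Lambda>"
    and K: "finite K" "\<And>V. V \<in> K \<Longrightarrow> card V = 3" "\<And>V. V \<in> K \<Longrightarrow> \<not> affine_dependent V"
    and F: "\<And>x y. F x = F y \<longleftrightarrow> x - y \<in> \<Lambda>"
    and FK: "interpolates K F F"
    and dist: "\<And>V v w. V \<in> K \<Longrightarrow> v \<in> V \<Longrightarrow> w \<in> V \<Longrightarrow> dist (F v) (F w) = dist v w"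
    and hat: "\<And>g :: real^3 \<Rightarrow> real.
      \<exists>G. (\<forall>x y. x - y \<in> \<Lambda> \<longrightarrow> G x = G y) \<and> interpolates K G (g \<circ> F)"
    and cover: "\<And>z. \<exists>V\<in>K. \<exists>x\<in>convex hull V. z - x \<in> \<Lambda>"
  shows "\<exists>f. origami_embedding \<Lambda> f"
proof -
  define f where "f = (\<lambda>X. F (SOME z. z \<in> X))"
  have f: "f (torus_proj \<Lambda> z) = F z" for z
  proof -
    have "(SOME x. x \<in> torus_proj \<Lambda> z) \<in> torus_proj \<Lambda> z"
      using torus_proj_self[OF L] by (rule someI)
    then show ?thesis
      unfolding f_def F by (auto simp: torus_proj_def)
  qed
  have proj_eq: "torus_proj \<Lambda> x = torus_proj \<Lambda> y \<longleftrightarrow> F x = F y" for x y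
    by (simp add: F torus_proj_eq_iff[OF L])
  have fin: "finite V" if "V \<in> K" for V
    using K(2)[OF that] card.infinite by force
  have inj: "inj_on F V" if "V \<in> K" for V
    using dist[OF that] by (metis dist_eq_0_iff inj_onI)
  have hullE: "\<exists>u. (\<forall>v\<in>V. 0 \<le> u v) \<and> sum u V = 1 \<and> x = (\<Sum>v\<in>V. u v *\<^sub>R v)"
    if "V \<in> K" "x \<in> convex hull V" for V x
    using that unfolding convex_hull_finite[OF fin[OF that(1)]] by auto
  have FI: "F (\<Sum>v\<in>V. u v *\<^sub>R v) = (\<Sum>v\<in>V. u v *\<^sub>R F v)"
    if "V \<in> K" "\<forall>v\<in>V. 0 \<le> u v" "sum u V = 1" for V u
    using FK that by (auto simp: interpolates_def)
  \<comment> \<open>The edge lengths of a triangle determine all distances between its points.\<close>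
  have norm_eq: "norm (\<Sum>v\<in>V. m v *\<^sub>R F v) = norm (\<Sum>v\<in>V. m v *\<^sub>R v)"
    if V: "V \<in> K" and m: "sum m V = 0" for V m
  proof -
    have "(norm (\<Sum>v\<in>V. m v *\<^sub>R F v))\<^sup>2 = (norm (\<Sum>v\<in>V. m v *\<^sub>R v))\<^sup>2"
      using norm_sum_zero_weights[OF fin[OF V] m, of F] norm_sum_zero_weights[OF fin[OF V] m, of "\<lambda>v. v"]
      by (simp add: dist[OF V] cong: sum.cong)
    then show ?thesis by (simp add: power2_eq_iff_nonneg)
  qed
  have isom: "dist (F x) (F y) = dist x y"
    if V: "V \<in> K" and xy: "x \<in> convex hull V" "y \<in> convex hull V" for V x y
  proof -
    obtain u where u: "\<forall>v\<in>V. 0 \<le> u v" "sum u V = 1" "x = (\<Sum>v\<in>V. u v *\<^sub>R v)"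
      using hullE[OF V xy(1)] by blast
    obtain w where w: "\<forall>v\<in>V. 0 \<le> w v" "sum w V = 1" "y = (\<Sum>v\<in>V. w v *\<^sub>R v)"
      using hullE[OF V xy(2)] by blast
    have "F x - F y = (\<Sum>v\<in>V. (u v - w v) *\<^sub>R F v)" "x - y = (\<Sum>v\<in>V. (u v - w v) *\<^sub>R v)"
      using FI[OF V u(1,2)] FI[OF V w(1,2)]
      by (simp_all add: u(3) w(3) scaleR_left_diff_distrib sum_subtractf)
    then show ?thesis
      using norm_eq[OF V, of "\<lambda>v. u v - w v"] by (simp add: dist_norm sum_subtractf u(2) w(2))
  qed
  have contF: "continuous_on UNIV F"
  proof -
    let ?C = "\<lambda>V. (\<lambda>x. (x, F x)) ` (convex hull V)"
    let ?T = "\<Lambda> \<times> {0 :: real^3}"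
    have cont: "continuous_on (convex hull V) F" if "V \<in> K" for V
      unfolding continuous_on_iff using isom[OF that] by metis
    have graph: "range (\<lambda>x. (x, F x)) = (\<Union>V\<in>K. \<Union>p\<in>?C V. \<Union>l\<in>?T. {p + l})"
    proof (intro subset_antisym subsetI)
      fix q assume "q \<in> range (\<lambda>x. (x, F x))"
      then obtain z where z: "q = (z, F z)" by auto
      obtain V x where V: "V \<in> K" "x \<in> convex hull V" "z - x \<in> \<Lambda>" using cover by blast
      then have "q = (x, F x) + (z - x, 0)" using F[of z x] by (simp add: z)
      then show "q \<in> (\<Union>V\<in>K. \<Union>p\<in>?C V. \<Union>l\<in>?T. {p + l})"
        using V by blast
    next
      fix q assume "q \<in> (\<Union>V\<in>K. \<Union>p\<in>?C V. \<Union>l\<in>?T. {p + l})"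
      then obtain x l where "l \<in> \<Lambda>" "q = (x + l, F x)" by auto
      then show "q \<in> range (\<lambda>x. (x, F x))"
        using F[of "x + l" x] by auto
    qed
    have "closed (range (\<lambda>x. (x, F x)))"
      unfolding graph
    proof (rule closed_UN[OF K(1)], rule ballI)
      fix V assume "V \<in> K"
      have "compact (convex hull V)"
        using fin[OF \<open>V \<in> K\<close>] by (simp add: finite_imp_compact_convex_hull)
      then have "compact (?C V)"
        by (intro compact_continuous_image continuous_intros cont \<open>V \<in> K\<close>)
      moreover have "closed ?T" by (intro closed_Times closed_lattice L closed_singleton)
      ultimately show "closed (\<Union>p\<in>?C V. \<Union>l\<in>?T. {p + l})" by (rule compact_closed_sums)
    qed
    moreover have "compact (\<Union>V\<in>K. F ` (convex hull V))"
      using K(1) fin by (auto intro!: compact_UN compact_continuous_image cont finite_imp_compact_convex_hull)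
    moreover have "F \<in> UNIV \<rightarrow> (\<Union>V\<in>K. F ` (convex hull V))"
      using cover F by (fastforce simp: Pi_iff)
    ultimately show ?thesis by (intro continuous_from_closed_graph)
  qed
  have contf: "continuous_map (torus_topology \<Lambda>) euclidean f"
    unfolding Metric_space.continuous_map_from_metric[OF Metric_space_flat_torus[OF L]]
  proof (intro conjI ballI allI impI)
    fix X U assume X: "X \<in> flat_torus \<Lambda>" and U: "openin euclidean U \<and> f X \<in> U"
    obtain x where x: "X = torus_proj \<Lambda> x" using X by (auto simp: flat_torus_def)
    have "open (F -` U)" using contF U by (simp add: continuous_on_open_vimage)
    moreover have "x \<in> F -` U" using U by (simp add: x f)
    ultimately obtain r where r: "r > 0" "ball x r \<subseteq> F -` U" using open_contains_ball by blast
    have "f Y \<in> U" if Y: "Y \<in> flat_torus \<Lambda>" "setdist X Y < r" for Y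
    proof -
      obtain y where y: "Y = torus_proj \<Lambda> y" using Y by (auto simp: flat_torus_def)
      have "Y \<noteq> {}" using torus_proj_self[OF L] y by auto
      have "setdist {x} Y < r" using Y(2) setdist_torus_proj[OF L] by (simp add: x y)
      then obtain b where "b \<in> Y" "dist x b < r"
        using setdist_ltE[of "{x}" Y r] \<open>Y \<noteq> {}\<close> by (metis insert_not_empty singletonD)
      then have "F b \<in> U" using r(2) by auto
      moreover have "F b = F y" using \<open>b \<in> Y\<close> by (auto simp: y F torus_proj_def)
      ultimately show ?thesis by (simp add: y f)
    qed
    then show "\<exists>r>0. \<forall>Y. Y \<in> flat_torus \<Lambda> \<and> setdist X Y < r \<longrightarrow> f Y \<in> U"
      using r(1) by blast
  qed auto
  have injf: "inj_on f (flat_torus \<Lambda>)"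
    by (auto simp: inj_on_def flat_torus_def f proj_eq)
  have affF: "\<not> affine_dependent (F ` V) \<and> card (F ` V) = 3" if V: "V \<in> K" for V
  proof -
    have False if dep: "affine_dependent (F ` V)"
    proof -
      obtain U where U: "sum U (F ` V) = 0" "\<exists>p\<in>F ` V. U p \<noteq> 0" "(\<Sum>p\<in>F ` V. U p *\<^sub>R p) = 0"
        using dep fin[OF V] by (auto simp: affine_dependent_explicit_finite)
      have s: "sum (\<lambda>v. U (F v)) V = 0" "(\<Sum>v\<in>V. U (F v) *\<^sub>R F v) = 0"
        using U(1,3) by (simp_all add: sum.reindex[OF inj[OF V]] o_def)
      then have "(\<Sum>v\<in>V. U (F v) *\<^sub>R v) = 0"
        using norm_eq[OF V s(1)] by simp
      then have "affine_dependent V"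
        using s(1) U(2) fin[OF V]
        by (auto simp: affine_dependent_explicit_finite intro!: exI[of _ "\<lambda>v. U (F v)"])
      then show False using K(3)[OF V] by blast
    qed
    then show ?thesis using card_image[OF inj[OF V]] K(2)[OF V] by auto
  qed
  have Fhull: "F ` (convex hull V) = convex hull (F ` V)" if V: "V \<in> K" for V
  proof (intro subset_antisym subsetI)
    fix p assume "p \<in> F ` (convex hull V)"
    then obtain x where x: "p = F x" "x \<in> convex hull V" by auto
    obtain u where u: "\<forall>v\<in>V. 0 \<le> u v" "sum u V = 1" "x = (\<Sum>v\<in>V. u v *\<^sub>R v)"
      using hullE[OF V x(2)] by blast
    have "F x = (\<Sum>v\<in>V. u v *\<^sub>R F v)" using FI[OF V u(1,2)] u(3) by simp
    also have "\<dots> \<in> convex hull (F ` V)"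
      by (rule convex_sum) (use u fin[OF V] in \<open>auto intro: hull_inc\<close>)
    finally show "p \<in> convex hull (F ` V)" by (simp add: x)
  next
    fix p assume "p \<in> convex hull (F ` V)"
    then obtain U where U: "\<forall>q\<in>F ` V. 0 \<le> U q" "sum U (F ` V) = 1" "p = (\<Sum>q\<in>F ` V. U q *\<^sub>R q)"
      unfolding convex_hull_finite[OF finite_imageI[OF fin[OF V]]] by auto
    have U': "\<forall>v\<in>V. 0 \<le> U (F v)" "sum (\<lambda>v. U (F v)) V = 1" "p = (\<Sum>v\<in>V. U (F v) *\<^sub>R F v)"
      using U by (simp_all add: sum.reindex[OF inj[OF V]] o_def)
    have "(\<Sum>v\<in>V. U (F v) *\<^sub>R v) \<in> convex hull V"
      by (rule convex_sum) (use U' fin[OF V] in \<open>auto intro: hull_inc\<close>)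
    then show "p \<in> F ` (convex hull V)"
      using FI[OF V U'(1,2)] U'(3) by (metis imageI)
  qed
  have isometric: "isometric_on_triangle \<Lambda> f (convex hull V)" if V: "V \<in> K" for V
  proof -
    have "f ` torus_proj \<Lambda> ` (convex hull V) = convex hull (F ` V)"
      by (simp add: image_image f Fhull[OF V, symmetric])
    moreover have "2 simplex (convex hull (F ` V))"
      using affF[OF V] by (intro simplex_convex_hull) auto
    ultimately show ?thesis
      using isom[OF V] by (simp add: isometric_on_triangle_def f)
  qed
  \<comment> \<open>A hat function is positive exactly on the open star of its vertex, so a vertex that
    contributes to a point belongs to every triangle through that point.\<close>
  have carrier: "F v \<in> F ` W"
    if V: "V \<in> K" and W: "W \<in> K" and u: "\<forall>v\<in>V. 0 \<le> u v" "sum u V = 1"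
      and y: "y \<in> convex hull W" "F (\<Sum>v\<in>V. u v *\<^sub>R v) = F y" and v: "v \<in> V" "u v > 0" for V W u y v
  proof (rule ccontr)
    assume nv: "F v \<notin> F ` W"
    define g :: "real^3 \<Rightarrow> real" where "g = (\<lambda>p. if p = F v then 1 else 0)"
    obtain G where G: "\<forall>x y. x - y \<in> \<Lambda> \<longrightarrow> G x = G y" "interpolates K G (g \<circ> F)"
      using hat[of g] by blast
    obtain w where w: "\<forall>v\<in>W. 0 \<le> w v" "sum w W = 1" "y = (\<Sum>v\<in>W. w v *\<^sub>R v)"
      using hullE[OF W y(1)] by blast
    have "G y = (\<Sum>v\<in>W. w v *\<^sub>R g (F v))"
      using G(2) W w by (simp add: interpolates_def)
    also have "\<dots> = 0"
    proof (intro sum.neutral ballI)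
      fix x assume "x \<in> W"
      then have "F x \<noteq> F v" using nv by (metis imageI)
      then show "w x *\<^sub>R g (F x) = 0" by (simp add: g_def)
    qed
    finally have "G y = 0" .
    have "G (\<Sum>v\<in>V. u v *\<^sub>R v) = (\<Sum>v\<in>V. u v *\<^sub>R g (F v))"
      using G(2) V u by (simp add: interpolates_def)
    moreover have "\<dots> \<ge> u v *\<^sub>R g (F v)"
      by (rule member_le_sum) (use v u fin[OF V] in \<open>auto simp: g_def\<close>)
    moreover have "G (\<Sum>v\<in>V. u v *\<^sub>R v) = G y"
      using G(1) y(2) F by blast
    ultimately show False using \<open>G y = 0\<close> v(2) by (simp add: g_def)
  qed
  have faces: "\<exists>A B. A face_of (convex hull V) \<and> B face_of (convex hull W) \<and>
      torus_proj \<Lambda> ` (convex hull V) \<inter> torus_proj \<Lambda> ` (convex hull W) = torus_proj \<Lambda> ` A \<and>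
      torus_proj \<Lambda> ` A = torus_proj \<Lambda> ` B" if V: "V \<in> K" and W: "W \<in> K" for V W
  proof -
    define A where "A = (\<lambda>V W. convex hull {v \<in> V. F v \<in> F ` W})"
    have face: "A V W face_of (convex hull V)" if "V \<in> K" for V W
      unfolding A_def face_of_convex_hull_affine_independent[OF K(3)[OF that]]
      by (rule exI[of _ "{v \<in> V. F v \<in> F ` W}"]) auto
    have sub: "torus_proj \<Lambda> ` (convex hull V) \<inter> torus_proj \<Lambda> ` (convex hull W) \<subseteq> torus_proj \<Lambda> ` A V W"
      if V: "V \<in> K" and W: "W \<in> K" for V W
    proof
      fix X assume "X \<in> torus_proj \<Lambda> ` (convex hull V) \<inter> torus_proj \<Lambda> ` (convex hull W)"
      then obtain x y where xy: "x \<in> convex hull V" "X = torus_proj \<Lambda> x"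
        "y \<in> convex hull W" "X = torus_proj \<Lambda> y" by auto
      obtain u where u: "\<forall>v\<in>V. 0 \<le> u v" "sum u V = 1" "x = (\<Sum>v\<in>V. u v *\<^sub>R v)"
        using hullE[OF V xy(1)] by blast
      have "F x = F y" using xy proj_eq by metis
      then have Fu: "F (\<Sum>v\<in>V. u v *\<^sub>R v) = F y" by (simp add: u(3))
      have c: "u v = 0" if v: "v \<in> V" "F v \<notin> F ` W" for v
      proof -
        have "\<not> u v > 0" using carrier[OF V W u(1,2) xy(3) Fu v(1)] v(2) by blast
        then show ?thesis using u(1) v(1) by force
      qed
      have "x = (\<Sum>v\<in>{v \<in> V. F v \<in> F ` W}. u v *\<^sub>R v)"
        unfolding u(3) by (rule sum.mono_neutral_right) (use fin[OF V] c in auto)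
      moreover have "sum u {v \<in> V. F v \<in> F ` W} = 1"
        unfolding u(2)[symmetric] by (rule sum.mono_neutral_left) (use fin[OF V] c in auto)
      ultimately have "x \<in> A V W"
        unfolding A_def convex_hull_finite[OF finite_subset[OF _ fin[OF V], of "{v \<in> V. F v \<in> F ` W}", simplified]]
        using u(1) by auto
      then show "X \<in> torus_proj \<Lambda> ` A V W" using xy by blast
    qed
    have A_subset: "A V W \<subseteq> convex hull V" for V W
      unfolding A_def by (rule hull_mono) auto
    \<comment> \<open>Both faces are mapped onto the convex hull of the common vertices in space, so they agree in the torus.\<close>
    have FA: "F ` A V W \<subseteq> convex hull (F ` V \<inter> F ` W)" if V: "V \<in> K" for V W
    proof
      fix p assume "p \<in> F ` A V W"
      then obtain x where x: "p = F x" "x \<in> A V W" by auto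
      let ?V = "{v \<in> V. F v \<in> F ` W}"
      have fV: "finite ?V" using fin[OF V] by auto
      obtain u where u: "\<forall>v\<in>?V. 0 \<le> u v" "sum u ?V = 1" "x = (\<Sum>v\<in>?V. u v *\<^sub>R v)"
        using x(2) unfolding A_def convex_hull_finite[OF fV] by auto
      define u' where "u' = (\<lambda>v. if v \<in> ?V then u v else 0)"
      have u': "\<forall>v\<in>V. 0 \<le> u' v" "sum u' V = 1" "x = (\<Sum>v\<in>V. u' v *\<^sub>R v)"
        using u(1) u(2,3)[symmetric] fin[OF V]
        by (auto simp: u'_def if_distrib[of "\<lambda>c. c *\<^sub>R _"] sum.If_cases Int_def cong: if_cong conj_cong)
      have "p = (\<Sum>v\<in>V. u' v *\<^sub>R F v)" using FI[OF V u'(1,2)] u'(3) x(1) by simp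
      also have "\<dots> = (\<Sum>v\<in>?V. u v *\<^sub>R F v)"
        using fin[OF V]
        by (simp add: u'_def if_distrib[of "\<lambda>c. c *\<^sub>R _"] sum.If_cases Int_def cong: if_cong conj_cong)
      also have "\<dots> \<in> convex hull (F ` V \<inter> F ` W)"
        by (rule convex_sum) (use u fV in \<open>auto intro: hull_inc\<close>)
      finally show "p \<in> convex hull (F ` V \<inter> F ` W)" .
    qed
    have FA': "convex hull (F ` V \<inter> F ` W) \<subseteq> F ` A V W" if V: "V \<in> K" for V W
    proof
      let ?V = "{v \<in> V. F v \<in> F ` W}"
      have im: "F ` V \<inter> F ` W = F ` ?V" by auto
      have fV: "finite ?V" using fin[OF V] by auto
      fix p assume "p \<in> convex hull (F ` V \<inter> F ` W)"
      then obtain U where U: "\<forall>q\<in>F ` ?V. 0 \<le> U q" "sum U (F ` ?V) = 1" "p = (\<Sum>q\<in>F ` ?V. U q *\<^sub>R q)"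
        unfolding im convex_hull_finite[OF finite_imageI[OF fV]] by auto
      have injV: "inj_on F ?V" using inj[OF V] by (rule inj_on_subset) auto
      define u where "u = (\<lambda>v. if v \<in> ?V then U (F v) else 0)"
      have u: "\<forall>v\<in>V. 0 \<le> u v" "sum u V = 1" "p = (\<Sum>v\<in>V. u v *\<^sub>R F v)"
        "(\<Sum>v\<in>V. u v *\<^sub>R v) = (\<Sum>v\<in>?V. U (F v) *\<^sub>R v)"
        using U fin[OF V]
        by (auto simp: u_def if_distrib[of "\<lambda>c. c *\<^sub>R _"] sum.If_cases Int_def sum.reindex[OF injV] o_def
            cong: if_cong conj_cong)
      have "(\<Sum>v\<in>?V. U (F v) *\<^sub>R v) \<in> A V W"
        unfolding A_def
        by (rule convex_sum) (use U fV in \<open>auto simp: sum.reindex[OF injV] intro: hull_inc\<close>)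
      then show "p \<in> F ` A V W"
        using FI[OF V u(1,2)] u(3,4) by (metis imageI)
    qed
    have eq: "F ` A V W = F ` A W V"
      using FA[OF V, of W] FA'[OF V, of W] FA[OF W, of V] FA'[OF W, of V] by (simp add: Int_commute)
    have half: "torus_proj \<Lambda> ` B \<subseteq> torus_proj \<Lambda> ` C" if BC: "F ` B \<subseteq> F ` C" for B C
    proof
      fix X assume "X \<in> torus_proj \<Lambda> ` B"
      then obtain b where b: "b \<in> B" "X = torus_proj \<Lambda> b" by blast
      then obtain c where "c \<in> C" "F b = F c" using BC by blast
      then show "X \<in> torus_proj \<Lambda> ` C" using b(2) proj_eq[of b c] by blast
    qed
    have proj_A: "torus_proj \<Lambda> ` A V W = torus_proj \<Lambda> ` A W V"
      using half[of "A V W" "A W V"] half[of "A W V" "A V W"] eq by auto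
    moreover have "torus_proj \<Lambda> ` (convex hull V) \<inter> torus_proj \<Lambda> ` (convex hull W) = torus_proj \<Lambda> ` A V W"
    proof
      have "torus_proj \<Lambda> ` A V W \<subseteq> torus_proj \<Lambda> ` (convex hull V)"
        using A_subset[of V W] by (rule image_mono)
      moreover have "torus_proj \<Lambda> ` A V W \<subseteq> torus_proj \<Lambda> ` (convex hull W)"
        unfolding proj_A using A_subset[of W V] by (rule image_mono)
      ultimately show "torus_proj \<Lambda> ` A V W
          \<subseteq> torus_proj \<Lambda> ` (convex hull V) \<inter> torus_proj \<Lambda> ` (convex hull W)"
        by (rule Int_greatest)
    qed (rule sub[OF V W])
    ultimately show ?thesis
      using face[OF V, of W] face[OF W, of V] by (intro exI conjI)
  qed
  have "torus_triangulation \<Lambda> ((hull) convex ` K)"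
    unfolding torus_triangulation_def
  proof (intro conjI ballI impI)
    show "finite ((hull) convex ` K)" using K(1) by simp
  next
    fix P assume "P \<in> (hull) convex ` K"
    then obtain V where V: "V \<in> K" "P = convex hull V" by auto
    then show "2 simplex P" using K by (auto intro!: simplex_convex_hull)
    show "inj_on (torus_proj \<Lambda>) P"
    proof (rule inj_onI)
      fix x y assume "x \<in> P" "y \<in> P" and eq: "torus_proj \<Lambda> x = torus_proj \<Lambda> y"
      then have "dist (F x) (F y) = dist x y" using isom[OF V(1)] V(2) by blast
      then show "x = y" using eq by (simp add: proj_eq)
    qed
  next
    show "(\<Union>P\<in>(hull) convex ` K. torus_proj \<Lambda> ` P) = flat_torus \<Lambda>"
    proof
      show "flat_torus \<Lambda> \<subseteq> (\<Union>P\<in>(hull) convex ` K. torus_proj \<Lambda> ` P)"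
      proof
        fix X assume "X \<in> flat_torus \<Lambda>"
        then obtain z where z: "X = torus_proj \<Lambda> z" by (auto simp: flat_torus_def)
        obtain V x where V: "V \<in> K" "x \<in> convex hull V" "z - x \<in> \<Lambda>" using cover by blast
        then have "X = torus_proj \<Lambda> x" using z torus_proj_eq_iff[OF L] by simp
        then show "X \<in> (\<Union>P\<in>(hull) convex ` K. torus_proj \<Lambda> ` P)" using V by auto
      qed
    qed (auto simp: flat_torus_def)
  next
    fix P Q assume "P \<in> (hull) convex ` K" "Q \<in> (hull) convex ` K"
    then obtain V W where "V \<in> K" "W \<in> K" "P = convex hull V" "Q = convex hull W" by blast
    then show "\<exists>A B. A face_of P \<and> B face_of Q \<and>
        torus_proj \<Lambda> ` P \<inter> torus_proj \<Lambda> ` Q = torus_proj \<Lambda> ` A \<and> torus_proj \<Lambda> ` A = torus_proj \<Lambda> ` B"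
      using faces by simp
  qed
  then have "origami_embedding \<Lambda> f"
    unfolding origami_embedding_def using injf contf isometric by blast
  then show ?thesis by blast
qed

section \<open>Interpolation on a stack of strips\<close>

text \<open>
The polygonal line that is cut out of a band at the level \<open>t\<close> by interpolating the corners \<open>P\<close> of the
lower and \<open>Q\<close> of the upper polygon. Its sides are alternately parallel to the sides of \<open>P\<close>, with
parameter length \<open>1 - t\<close>, and to those of \<open>Q\<close>, with parameter length \<open>t\<close>.
\<close>

definition band_map :: "(int \<Rightarrow> 'e::real_vector) \<Rightarrow> (int \<Rightarrow> 'e) \<Rightarrow> real \<Rightarrow> real \<Rightarrow> 'e" where
  "band_map P Q t r = (let k = \<lfloor>r\<rfloor>; f = frac r in
     if f \<le> 1 - t then (1 - t - f) *\<^sub>R P k + f *\<^sub>R P (k + 1) + t *\<^sub>R Q k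
     else (1 - t) *\<^sub>R P (k + 1) + (1 - f) *\<^sub>R Q k + (f + t - 1) *\<^sub>R Q (k + 1))"

text \<open>
The two branches agree where they meet, and at integers the branch for \<open>k\<close> at its right end agrees with
the one for \<open>k + 1\<close> at its left end. Hence both formulas hold on closed parameter intervals.
\<close>

lemma band_map_lower:
  assumes "0 \<le> t" "0 \<le> f" "f \<le> 1 - t"
  shows "band_map P Q t (of_int k + f) = (1 - t - f) *\<^sub>R P k + f *\<^sub>R P (k + 1) + t *\<^sub>R Q k"
proof (cases "f = 1")
  case True
  then have "t = 0" using assms by simp
  have "\<lfloor>of_int k + f\<rfloor> = k + 1" "frac (of_int k + f) = 0" using True by (auto simp: frac_def)
  then show ?thesis using True \<open>t = 0\<close> by (simp add: band_map_def Let_def)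
next
  case False
  then have "f < 1" using assms by simp
  then have "\<lfloor>of_int k + f\<rfloor> = k" using assms by (simp add: floor_eq_iff)
  moreover from this have "frac (of_int k + f) = f" by (simp add: frac_def)
  ultimately show ?thesis using assms by (simp add: band_map_def)
qed

lemma band_map_upper:
  assumes "t \<le> 1" "1 - t \<le> f" "f \<le> 1"
  shows "band_map P Q t (of_int k + f) =
    (1 - t) *\<^sub>R P (k + 1) + (1 - f) *\<^sub>R Q k + (f + t - 1) *\<^sub>R Q (k + 1)"
proof (cases "f = 1")
  case True
  have "\<lfloor>of_int k + f\<rfloor> = k + 1" "frac (of_int k + f) = 0" using True by (auto simp: frac_def)
  then show ?thesis using True assms by (simp add: band_map_def Let_def)
next
  case False
  then have "\<lfloor>of_int k + f\<rfloor> = k" using assms by (simp add: floor_eq_iff)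
  moreover from this have "frac (of_int k + f) = f" by (simp add: frac_def)
  ultimately have *: "\<lfloor>of_int k + f\<rfloor> = k" "frac (of_int k + f) = f" .
  show ?thesis
  proof (cases "f \<le> 1 - t")
    case True
    then have t: "t = 1 - f" using assms by simp
    show ?thesis unfolding band_map_def Let_def * t by simp
  next
    case False
    then show ?thesis unfolding band_map_def Let_def * by simp
  qed
qed

lemma band_map_cases:
  fixes r t :: real
  assumes "0 \<le> t" "t \<le> 1"
  obtains (lower) k f where "r = of_int k + f" "0 \<le> f" "f \<le> 1 - t" "f < 1"
  | (upper) k f where "r = of_int k + f" "1 - t < f" "f < 1"
proof -
  have "r = of_int \<lfloor>r\<rfloor> + frac r" "0 \<le> frac r" "frac r < 1"
    by (auto simp: frac_def frac_lt_1) linarith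
  then show thesis using that by (metis linorder_not_le)
qed

lemma band_map_shift: "band_map P Q t (r + of_int m) = band_map (\<lambda>i. P (i + m)) (\<lambda>i. Q (i + m)) t r"
  by (simp add: band_map_def frac_def Let_def algebra_simps)

lemma band_map_1: "band_map P Q 1 r = band_map Q Q' 0 r"
proof -
  obtain f where f: "frac r = f" "0 \<le> f" "f < 1" using frac_lt_1[of r] frac_ge_0[of r] by blast
  show ?thesis unfolding band_map_def Let_def f(1) using f(2,3) by (cases "f = 0") auto
qed

text \<open>
The plane is cut into horizontal strips at the heights \<open>y j\<close>; on the line at height \<open>y j\<close> the
vertices have distance \<open>s\<close> and are shifted by \<open>x j\<close>. The top line is identified with the bottom line
after a shift of the vertices by \<open>\<kappa>\<close> places, and \<open>n\<close> vertices make up one horizontal period.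
\<close>

locale flat_strip =
  fixes N n :: nat and s :: real and x y :: "nat \<Rightarrow> real" and \<kappa> :: int
  assumes N: "N > 0" and n: "n > 0" and s: "s > 0"
    and x0: "x 0 = 0" and y0: "y 0 = 0" and y_step: "\<And>j. j < N \<Longrightarrow> y j < y (Suc j)"
begin

definition vertex :: "nat \<Rightarrow> int \<Rightarrow> complex" where
  "vertex j i = Complex (x j + of_int i * s) (y j)"

definition strip_point :: "nat \<Rightarrow> real \<Rightarrow> real \<Rightarrow> complex" where
  "strip_point j t r = Complex ((1 - t) * x j + t * x (Suc j) + r * s) ((1 - t) * y j + t * y (Suc j))"

definition hperiod :: complex where "hperiod = of_real (real n * s)"
definition vperiod :: complex where "vperiod = Complex (x N - of_int \<kappa> * s) (y N)"

abbreviation periods :: "complex set" where "periods \<equiv> lattice_gen hperiod vperiod"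

definition strip_map :: "(nat \<Rightarrow> int \<Rightarrow> 'e::real_vector) \<Rightarrow> complex \<Rightarrow> 'e" where
  "strip_map g z = (let z' = z - of_int \<lfloor>Im z / y N\<rfloor> * vperiod;
     j = (LEAST j. Im z' < y (Suc j));
     t = (Im z' - y j) / (y (Suc j) - y j);
     r = (Re z' - (1 - t) * x j - t * x (Suc j)) / s
   in band_map (g j) (g (Suc j)) t r)"

definition vertex_data :: "(nat \<Rightarrow> int \<Rightarrow> 'e) \<Rightarrow> bool" where
  "vertex_data g \<longleftrightarrow> (\<forall>j i. g j (i + int n) = g j i) \<and> (\<forall>i. g N i = g 0 (i + \<kappa>))"

lemma y_mono: "i \<le> j \<Longrightarrow> j \<le> N \<Longrightarrow> y i \<le> y j"
proof (induction j)
  case (Suc j)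
  then show ?case using y_step[of j] by (cases "i = Suc j") auto
qed simp

lemma yN: "y N > 0"
  using y_step[of 0] y_mono[of 1 N] N y0 by auto

lemma strip_map_strip_point_less:
  assumes "j < N" "0 \<le> t" "t < 1"
  shows "strip_map g (strip_point j t r + of_int q * vperiod) = band_map (g j) (g (Suc j)) t r"
proof -
  let ?Y = "(1 - t) * y j + t * y (Suc j)"
  have Yeq: "?Y = y j + t * (y (Suc j) - y j)" by (simp add: algebra_simps)
  have st: "y (Suc j) - y j > 0" using y_step[OF assms(1)] by simp
  have Y1: "y j \<le> ?Y" using st assms(2) by (simp add: Yeq)
  have "t * (y (Suc j) - y j) < 1 * (y (Suc j) - y j)"
    by (rule mult_strict_right_mono[OF assms(3) st])
  then have Y2: "?Y < y (Suc j)" by (simp add: Yeq)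
  have Y: "0 \<le> ?Y" "?Y < y N"
    using Y1 Y2 y_mono[of 0 j] y_mono[of "Suc j" N] y0 assms(1) by auto
  have "Im (strip_point j t r + of_int q * vperiod) / y N = of_int q + ?Y / y N"
    using yN by (simp add: strip_point_def vperiod_def field_simps)
  moreover have "0 \<le> ?Y / y N" "?Y / y N < 1" using Y yN by auto
  ultimately have q: "\<lfloor>Im (strip_point j t r + of_int q * vperiod) / y N\<rfloor> = q"
    by (simp add: floor_eq_iff)
  have j: "(LEAST i. ?Y < y (Suc i)) = j"
  proof (rule Least_equality)
    show "?Y < y (Suc j)" by (rule Y2)
    fix i assume i: "?Y < y (Suc i)"
    show "j \<le> i"
    proof (rule ccontr)
      assume "\<not> j \<le> i"
      then have "y (Suc i) \<le> y j" using assms(1) by (intro y_mono) auto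
      then show False using i Y1 by simp
    qed
  qed
  have im: "Im (strip_point j t r) = ?Y" by (simp add: strip_point_def)
  have t: "(?Y - y j) / (y (Suc j) - y j) = t" using st by (simp add: Yeq)
  show ?thesis
    unfolding strip_map_def Let_def q
    using s by (simp add: im j t) (simp add: strip_point_def)
qed

lemma strip_point_cases:
  obtains j t r q where "j < N" "0 \<le> t" "t < 1" "z = strip_point j t r + of_int q * vperiod"
proof -
  define q where "q = \<lfloor>Im z / y N\<rfloor>"
  define z' where "z' = z - of_int q * vperiod"
  have "of_int q \<le> Im z / y N" "Im z / y N < of_int q + 1" by (simp_all add: q_def)
  then have "of_int q * y N \<le> Im z" "Im z < (of_int q + 1) * y N"
    using yN by (simp_all add: field_simps)
  then have z': "0 \<le> Im z'" "Im z' < y N"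
    by (simp_all add: z'_def vperiod_def algebra_simps)
  define j where "j = (LEAST j. Im z' < y (Suc j))"
  have ex: "Im z' < y (Suc (N - 1))" using z' N by simp
  have j: "Im z' < y (Suc j)" unfolding j_def using ex by (rule LeastI)
  have "j \<le> N - 1" unfolding j_def using ex by (rule Least_le)
  then have jN: "j < N" using N by simp
  have yj: "y j \<le> Im z'"
  proof (cases j)
    case 0 then show ?thesis using y0 z' by simp
  next
    case (Suc i)
    then show ?thesis using not_less_Least[of i "\<lambda>j. Im z' < y (Suc j)"] j_def by simp
  qed
  have st: "y (Suc j) - y j > 0" using y_step[OF jN] by simp
  define t where "t = (Im z' - y j) / (y (Suc j) - y j)"
  define r where "r = (Re z' - (1 - t) * x j - t * x (Suc j)) / s"
  have t: "0 \<le> t" "t < 1" using yj j st by (simp_all add: t_def)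
  have "t * (y (Suc j) - y j) = Im z' - y j" using st by (simp add: t_def)
  then have "(1 - t) * y j + t * y (Suc j) = Im z'" by (simp add: algebra_simps)
  moreover have "(1 - t) * x j + t * x (Suc j) + r * s = Re z'" using s by (simp add: r_def)
  ultimately have "z' = strip_point j t r" by (simp add: strip_point_def complex_eq_iff)
  then have "z = strip_point j t r + of_int q * vperiod" by (simp add: z'_def diff_eq_eq)
  then show thesis using that jN t by blast
qed

lemma vertex_data_periodic:
  assumes "vertex_data g" shows "g j (i + int n * m) = g j i"
proof -
  have "g j (i + int n * int k) = g j i" for i k
  proof (induction k)
    case (Suc k)
    have "g j ((i + int n * int k) + int n) = g j (i + int n * int k)"
      using assms by (simp only: vertex_data_def)
    with Suc show ?case by (simp add: algebra_simps)
  qed simp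
  from this[of i "nat m"] this[of "i + int n * m" "nat (- m)"] show ?thesis
    by (cases "m \<ge> 0") (auto simp: algebra_simps)
qed

text \<open>
At the upper boundary \<open>t = 1\<close> the formula of the next strip takes over, or that of the first strip
one vertical period up; both restrict to the same map on the line.
\<close>

lemma strip_map_strip_point:
  assumes g: "vertex_data g" and "j < N" "0 \<le> t" "t \<le> 1"
  shows "strip_map g (strip_point j t r + of_int q * vperiod) = band_map (g j) (g (Suc j)) t r"
proof (cases "t = 1")
  case False then show ?thesis using assms by (intro strip_map_strip_point_less) auto
next
  case t: True
  have 1: "band_map (g j) (g (Suc j)) t r = band_map (g (Suc j)) Q 0 r" for Q
    unfolding t by (rule band_map_1)
  show ?thesis
  proof (cases "Suc j < N")
    case True
    have "strip_point j t r = strip_point (Suc j) 0 r" by (simp add: strip_point_def t)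
    then show ?thesis unfolding 1[of "g (Suc (Suc j))"]
      using strip_map_strip_point_less[OF True, of 0] by simp
  next
    case False
    then have j: "Suc j = N" using assms by simp
    have "strip_point j t r + of_int q * vperiod = strip_point 0 0 (r + of_int \<kappa>) + of_int (q + 1) * vperiod"
      by (simp add: strip_point_def t j vperiod_def x0 y0 complex_eq_iff algebra_simps)
    then have "strip_map g (strip_point j t r + of_int q * vperiod) = band_map (g 0) (g (Suc 0)) 0 (r + of_int \<kappa>)"
      using strip_map_strip_point_less[OF N, of 0 g "r + of_int \<kappa>" "q + 1"] by simp
    also have "\<dots> = band_map (g N) (\<lambda>i. g (Suc 0) (i + \<kappa>)) 0 r"
    proof -
      have "(\<lambda>i. g 0 (i + \<kappa>)) = g N" using g by (intro ext) (simp add: vertex_data_def)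
      then show ?thesis by (simp only: band_map_shift)
    qed
    also have "\<dots> = band_map (g j) (g (Suc j)) t r"
      using 1 by (simp add: j)
    finally show ?thesis .
  qed
qed

lemma mem_periods_iff: "w \<in> periods \<longleftrightarrow> (\<exists>m k. w = of_int m * hperiod + of_int k * vperiod)"
  by (auto simp: lattice_gen_def)

lemma strip_map_periodic:
  assumes g: "vertex_data g" and "u - v \<in> periods"
  shows "strip_map g u = strip_map g v"
proof -
  obtain m k where mk: "u - v = of_int m * hperiod + of_int k * vperiod"
    using assms(2) by (auto simp: mem_periods_iff)
  obtain j t r q where v: "j < N" "0 \<le> t" "t < 1" "v = strip_point j t r + of_int q * vperiod"
    by (rule strip_point_cases)
  have "u = v + of_int m * hperiod + of_int k * vperiod" using mk by (simp add: algebra_simps)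
  also have "\<dots> = strip_point j t (r + of_int (int n * m)) + of_int (q + k) * vperiod"
    by (simp add: v(4) strip_point_def hperiod_def complex_eq_iff algebra_simps)
  finally have u: "u = strip_point j t (r + of_int (int n * m)) + of_int (q + k) * vperiod" .
  have "strip_map g u = band_map (g j) (g (Suc j)) t (r + of_int (int n * m))"
    unfolding u by (rule strip_map_strip_point_less[OF v(1-3)])
  also have "\<dots> = band_map (g j) (g (Suc j)) t r"
    by (simp only: band_map_shift vertex_data_periodic[OF g])
  finally show ?thesis unfolding v(4) by (simp only: strip_map_strip_point_less[OF v(1-3)])
qed

lemma lattice_periods: "is_lattice periods"
  unfolding is_lattice_def
proof (intro exI conjI)
  have nz: "hperiod \<noteq> 0" "Im vperiod \<noteq> 0" "Im hperiod = 0"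
    using n s yN by (auto simp: hperiod_def vperiod_def)
  show "hperiod \<noteq> vperiod" using nz by auto
  have "vperiod \<notin> span {hperiod}" using nz by (auto simp: span_singleton)
  then have "independent {vperiod, hperiod}"
    using nz by (simp add: independent_insert)
  then show "independent {hperiod, vperiod}" by (simp add: insert_commute)
qed simp

definition lower_triangle :: "nat \<Rightarrow> int \<Rightarrow> complex set" where
  "lower_triangle j i = {vertex j i, vertex j (i + 1), vertex (Suc j) i}"
definition upper_triangle :: "nat \<Rightarrow> int \<Rightarrow> complex set" where
  "upper_triangle j i = {vertex j (i + 1), vertex (Suc j) i, vertex (Suc j) (i + 1)}"

definition triangles :: "complex set set" where
  "triangles = (\<Union>j<N. \<Union>i\<in>{0..<int n}. {lower_triangle j i, upper_triangle j i})"

lemma vertex_eq_iff: "j < N \<Longrightarrow> vertex j i = vertex j i' \<longleftrightarrow> i = i'"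
  "vertex (Suc j) i = vertex (Suc j) i' \<longleftrightarrow> i = i'"
  "j < N \<Longrightarrow> vertex j i \<noteq> vertex (Suc j) i'" "j < N \<Longrightarrow> vertex (Suc j) i' \<noteq> vertex j i"
  using s y_step[of j] by (auto simp: vertex_def)

lemma sum_lower_triangle:
  fixes h :: "complex \<Rightarrow> 'e::comm_monoid_add"
  shows "j < N \<Longrightarrow> sum h (lower_triangle j i) = h (vertex j i) + (h (vertex j (i + 1)) + h (vertex (Suc j) i))"
  by (simp add: lower_triangle_def vertex_eq_iff)

lemma sum_upper_triangle:
  fixes h :: "complex \<Rightarrow> 'e::comm_monoid_add"
  shows "j < N \<Longrightarrow> sum h (upper_triangle j i) =
    h (vertex j (i + 1)) + (h (vertex (Suc j) i) + h (vertex (Suc j) (i + 1)))"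
  by (simp add: upper_triangle_def vertex_eq_iff)

lemma triangleE:
  assumes "V \<in> triangles"
  obtains (lower) j i where "j < N" "V = lower_triangle j i"
  | (upper) j i where "j < N" "V = upper_triangle j i"
  using assms unfolding triangles_def by blast

lemma finite_triangles: "finite triangles"
  by (simp add: triangles_def)

lemma card_triangle: "V \<in> triangles \<Longrightarrow> card V = 3"
  by (erule triangleE) (auto simp: lower_triangle_def upper_triangle_def vertex_eq_iff)

lemma triangle_independent:
  assumes "V \<in> triangles" shows "\<not> affine_dependent V"
proof
  assume dep: "affine_dependent V"
  have "finite V" using card_triangle[OF assms] card.infinite by force
  then obtain U where U: "sum U V = 0" "\<exists>v\<in>V. U v \<noteq> 0" "(\<Sum>v\<in>V. U v *\<^sub>R v) = 0"
    using dep by (auto simp: affine_dependent_explicit_finite)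
  have key: "a = 0 \<and> b = 0 \<and> c = 0"
    if "a + (b + c) = 0" "j < N" "i \<noteq> i'" "{p, q} = {j, Suc j}"
      "a *\<^sub>R vertex p i + (b *\<^sub>R vertex p i' + c *\<^sub>R vertex q k) = 0" for a b c p q j i i' k
  proof -
    have yy: "y p \<noteq> y q" using that(2,4) y_step[of j] by (auto simp: doubleton_eq_iff)
    have "a * y p + (b * y p + c * y q) = 0"
      using that(5) by (simp add: vertex_def complex_eq_iff)
    moreover have "a * y p + (b * y p + c * y p) = 0"
      using that(1) by (metis distrib_right mult_zero_left)
    ultimately have "c * (y q - y p) = 0" unfolding right_diff_distrib by linarith
    then have c: "c = 0" using yy by simp
    then have "b = - a" using that(1) by simp
    then have "a * ((of_int i - of_int i') * s) = 0"
      using that(5) c by (simp add: vertex_def complex_eq_iff algebra_simps)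
    then show ?thesis using c \<open>b = - a\<close> that(3) s by simp
  qed
  from assms show False
  proof (cases rule: triangleE)
    case (lower j i)
    have "U (vertex j i) = 0 \<and> U (vertex j (i + 1)) = 0 \<and> U (vertex (Suc j) i) = 0"
      using U(1,3) lower by (intro key[of _ _ _ j _ _ j "Suc j"])
        (auto simp: sum_lower_triangle)
    then show False using U(2) by (auto simp: lower lower_triangle_def)
  next
    case (upper j i)
    have "U (vertex (Suc j) i) = 0 \<and> U (vertex (Suc j) (i + 1)) = 0 \<and> U (vertex j (i + 1)) = 0"
      using U(1,3) upper by (intro key[of _ _ _ j _ _ "Suc j" j])
        (auto simp: sum_upper_triangle algebra_simps)
    then show False using U(2) by (auto simp: upper upper_triangle_def)
  qed
qed

lemma strip_map_lower:
  assumes g: "vertex_data g" and j: "j < N" and abc: "0 \<le> a" "0 \<le> b" "0 \<le> c" "a + (b + c) = 1"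
  shows "strip_map g (a *\<^sub>R vertex j i + (b *\<^sub>R vertex j (i + 1) + c *\<^sub>R vertex (Suc j) i))
    = a *\<^sub>R g j i + (b *\<^sub>R g j (i + 1) + c *\<^sub>R g (Suc j) i)"
proof -
  have a: "a = 1 - c - b" using abc by simp
  have "a *\<^sub>R vertex j i + (b *\<^sub>R vertex j (i + 1) + c *\<^sub>R vertex (Suc j) i) = strip_point j c (of_int i + b)"
    by (simp add: vertex_def strip_point_def complex_eq_iff a algebra_simps)
  then show ?thesis
    using strip_map_strip_point[OF g j, of c "of_int i + b" 0] band_map_lower[of c b "g j" "g (Suc j)" i] abc
    by (simp add: a)
qed

lemma strip_map_upper:
  assumes g: "vertex_data g" and j: "j < N" and abc: "0 \<le> a" "0 \<le> b" "0 \<le> c" "a + (b + c) = 1"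
  shows "strip_map g (a *\<^sub>R vertex j (i + 1) + (b *\<^sub>R vertex (Suc j) i + c *\<^sub>R vertex (Suc j) (i + 1)))
    = a *\<^sub>R g j (i + 1) + (b *\<^sub>R g (Suc j) i + c *\<^sub>R g (Suc j) (i + 1))"
proof -
  have a: "a = 1 - (b + c)" using abc by simp
  have "a *\<^sub>R vertex j (i + 1) + (b *\<^sub>R vertex (Suc j) i + c *\<^sub>R vertex (Suc j) (i + 1))
      = strip_point j (b + c) (of_int i + (1 - b))"
    by (simp add: vertex_def strip_point_def complex_eq_iff a algebra_simps)
  then show ?thesis
    using strip_map_strip_point[OF g j, of "b + c" "of_int i + (1 - b)" 0]
      band_map_upper[of "b + c" "1 - b" "g j" "g (Suc j)" i] abc
    by (simp add: a)
qed

lemma strip_map_vertex: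
  assumes "vertex_data g" "j < N"
  shows "strip_map g (vertex j i) = g j i" "strip_map g (vertex (Suc j) i) = g (Suc j) i"
  using strip_map_lower[OF assms, of 1 0 0 i] strip_map_lower[OF assms, of 0 0 1 i] by simp_all

lemma strip_map_interpolates:
  assumes g: "vertex_data g"
  shows "interpolates triangles (strip_map g) (strip_map g)"
  unfolding interpolates_def
proof (intro ballI allI impI)
  fix V and u :: "complex \<Rightarrow> real" assume V: "V \<in> triangles" and u: "(\<forall>v\<in>V. 0 \<le> u v) \<and> sum u V = 1"
  from V show "strip_map g (\<Sum>v\<in>V. u v *\<^sub>R v) = (\<Sum>v\<in>V. u v *\<^sub>R strip_map g v)"
  proof (cases rule: triangleE)
    case (lower j i)
    then show ?thesis using u
      by (simp add: sum_lower_triangle strip_map_vertex[OF g])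
        (rule strip_map_lower[OF g], auto simp: lower_triangle_def)
  next
    case (upper j i)
    then show ?thesis using u
      by (simp add: sum_upper_triangle strip_map_vertex[OF g])
        (rule strip_map_upper[OF g], auto simp: upper_triangle_def)
  qed
qed

text \<open>
Reducing the integer part of the horizontal parameter modulo \<open>n\<close> moves a point by a multiple of the
horizontal period into one of the finitely many triangles.
\<close>

lemma triangles_cover: "\<exists>V\<in>triangles. \<exists>p\<in>convex hull V. z - p \<in> periods"
proof -
  obtain j t r q where z: "j < N" "0 \<le> t" "t < 1" "z = strip_point j t r + of_int q * vperiod"
    by (rule strip_point_cases)
  have hull: "a *\<^sub>R u + b *\<^sub>R v + c *\<^sub>R w \<in> convex hull {u, v, w}"
    if "0 \<le> a" "0 \<le> b" "0 \<le> c" "a + b + c = 1" for a b c and u v w :: complex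
    unfolding convex_hull_3 using that by blast
  have red: "z - p \<in> periods" if "p = strip_point j t (r - of_int (int n * m))" for p m
  proof -
    have "z - p = of_int m * hperiod + of_int q * vperiod"
      using that by (simp add: z(4) strip_point_def hperiod_def complex_eq_iff algebra_simps)
    then show ?thesis unfolding mem_periods_iff by blast
  qed
  have i: "k mod int n \<in> {0..<int n}" "of_int k = of_int (k mod int n) + real n * of_int (k div int n)" for k
  proof -
    show "k mod int n \<in> {0..<int n}" using n by simp
    have "k mod int n + int n * (k div int n) = k" by (rule mod_mult_div_eq)
    from arg_cong[OF this[symmetric], of real_of_int]
    show "of_int k = of_int (k mod int n) + real n * of_int (k div int n)"
      by (simp only: of_int_add of_int_mult of_int_of_nat_eq)
  qed
  show ?thesis
  proof (rule band_map_cases[OF z(2) less_imp_le[OF z(3)], of r])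
    fix k f assume lower: "r = of_int k + f" "0 \<le> f" "f \<le> 1 - t" "f < 1"
    let ?i = "k mod int n"
    let ?p = "(1 - t - f) *\<^sub>R vertex j ?i + f *\<^sub>R vertex j (?i + 1) + t *\<^sub>R vertex (Suc j) ?i"
    have "?p = strip_point j t (r - of_int (int n * (k div int n)))"
      using lower(1) i(2)[of k] by (simp add: strip_point_def vertex_def complex_eq_iff algebra_simps)
    then have "z - ?p \<in> periods" by (rule red)
    moreover have "?p \<in> convex hull (lower_triangle j ?i)"
      unfolding lower_triangle_def using lower z by (intro hull) auto
    moreover have "lower_triangle j ?i \<in> triangles" using z(1) i(1)[of k] unfolding triangles_def by blast
    ultimately show ?thesis by blast
  next
    fix k f assume upper: "r = of_int k + f" "1 - t < f" "f < 1"
    let ?i = "k mod int n"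
    let ?p = "(1 - t) *\<^sub>R vertex j (?i + 1) + (1 - f) *\<^sub>R vertex (Suc j) ?i + (f + t - 1) *\<^sub>R vertex (Suc j) (?i + 1)"
    have "?p = strip_point j t (r - of_int (int n * (k div int n)))"
      using upper(1) i(2)[of k] by (simp add: strip_point_def vertex_def complex_eq_iff algebra_simps)
    then have "z - ?p \<in> periods" by (rule red)
    moreover have "?p \<in> convex hull (upper_triangle j ?i)"
      unfolding upper_triangle_def using upper z by (intro hull) auto
    moreover have "upper_triangle j ?i \<in> triangles" using z(1) i(1)[of k] unfolding triangles_def by blast
    ultimately show ?thesis by blast
  qed
qed

text \<open>
Both the map into space and its hat functions are interpolations of vertex values, so one explicit
formula serves all hypotheses of the general criterion. What is left to check concerns edge
lengths and the injectivity of the vertex configuration in space.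
\<close>

theorem origami_embedding_of_strip:
  fixes g :: "nat \<Rightarrow> int \<Rightarrow> real^3"
  assumes g: "vertex_data g"
    and len: "\<And>j i. j \<le> N \<Longrightarrow> dist (g j i) (g j (i + 1)) = s"
      "\<And>j i. j < N \<Longrightarrow> dist (g j i) (g (Suc j) i) = dist (vertex j i) (vertex (Suc j) i)"
      "\<And>j i. j < N \<Longrightarrow> dist (g j (i + 1)) (g (Suc j) i) = dist (vertex j (i + 1)) (vertex (Suc j) i)"
    and inj: "\<And>j t r j' t' r'. \<lbrakk>j < N; 0 \<le> t; t < 1; j' < N; 0 \<le> t'; t' < 1;
        band_map (g j) (g (Suc j)) t r = band_map (g j') (g (Suc j')) t' r'\<rbrakk>
      \<Longrightarrow> j = j' \<and> t = t' \<and> (\<exists>m. r - r' = of_int m * real n)"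
  shows "\<exists>f. origami_embedding periods f"
proof (rule origami_embedding_of_PL_map[where F = "strip_map g" and K = triangles])
  show "is_lattice periods" by (rule lattice_periods)
  show "finite triangles" by (rule finite_triangles)
  show "card V = 3" "\<not> affine_dependent V" if "V \<in> triangles" for V
    using that by (rule card_triangle triangle_independent)+
  show "interpolates triangles (strip_map g) (strip_map g)"
    by (rule strip_map_interpolates[OF g])
  show "\<exists>V\<in>triangles. \<exists>p\<in>convex hull V. z - p \<in> periods" for z
    by (rule triangles_cover)
  show "strip_map g u = strip_map g v \<longleftrightarrow> u - v \<in> periods" for u v
  proof
    assume eq: "strip_map g u = strip_map g v"
    obtain j t r q where u: "j < N" "0 \<le> t" "t < 1" "u = strip_point j t r + of_int q * vperiod"
      by (rule strip_point_cases)
    obtain j' t' r' q' where v: "j' < N" "0 \<le> t'" "t' < 1" "v = strip_point j' t' r' + of_int q' * vperiod"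
      by (rule strip_point_cases)
    have "j = j' \<and> t = t' \<and> (\<exists>m. r - r' = of_int m * real n)"
      using inj[OF u(1-3) v(1-3)] eq
        strip_map_strip_point_less[OF u(1-3), of g r q] strip_map_strip_point_less[OF v(1-3), of g r' q'] u(4) v(4)
      by simp
    then obtain m where m: "j = j'" "t = t'" "r = r' + of_int m * real n"
      by (auto simp: algebra_simps)
    have "u - v = of_int m * hperiod + of_int (q - q') * vperiod"
      by (simp add: u(4) v(4) m strip_point_def hperiod_def complex_eq_iff algebra_simps)
    then show "u - v \<in> periods" unfolding mem_periods_iff by blast
  qed (rule strip_map_periodic[OF g])
  show "dist (strip_map g v) (strip_map g w) = dist v w"
    if "V \<in> triangles" "v \<in> V" "w \<in> V" for V v w
  proof -
    have edge: "dist (g j i) (g j (i + 1)) = dist (vertex j i) (vertex j (i + 1))" if "j \<le> N" for j i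
      unfolding len(1)[OF that] using s by (simp add: vertex_def dist_norm cmod_def algebra_simps)
    from that(1) show ?thesis
    proof (cases rule: triangleE)
      case (lower j i)
      then show ?thesis using that(2,3) len(2,3)[of j i] edge[of j i]
        by (auto simp: lower_triangle_def strip_map_vertex[OF g] dist_commute)
    next
      case (upper j i)
      then show ?thesis using that(2,3) len(2)[of j "i + 1"] len(3)[of j i] edge[of "Suc j" i]
        by (auto simp: upper_triangle_def strip_map_vertex[OF g] dist_commute)
    qed
  qed
  fix h :: "real^3 \<Rightarrow> real"
  let ?h = "\<lambda>j i. h (g j i)"
  have h: "vertex_data ?h" using g by (simp add: vertex_data_def)
  have "strip_map ?h v = (h \<circ> strip_map g) v" if "V \<in> triangles" "v \<in> V" for V v
    using that(1)
  proof (cases rule: triangleE)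
    case (lower j i)
    then show ?thesis using that(2)
      by (auto simp: lower_triangle_def strip_map_vertex[OF g] strip_map_vertex[OF h])
  next
    case (upper j i)
    then show ?thesis using that(2)
      by (auto simp: upper_triangle_def strip_map_vertex[OF g] strip_map_vertex[OF h])
  qed
  then have "interpolates triangles (strip_map ?h) (h \<circ> strip_map g)"
    using strip_map_interpolates[OF h] by (simp add: interpolates_def cong: sum.cong)
  then show "\<exists>G. (\<forall>u v. u - v \<in> periods \<longrightarrow> G u = G v) \<and> interpolates triangles G (h \<circ> strip_map g)"
    using strip_map_periodic[OF h] by blast
qed

end

section \<open>Horizontal slices of a band\<close>

text \<open>
Turning a band upside down exchanges the two families of sides; as the traversal is then reversed, the
alternation again starts with the sides that belong to the new lower polygon.
\<close>

lemma band_map_flip: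
  assumes t: "0 \<le> t" "t \<le> 1"
  shows "band_map P Q t r = band_map (\<lambda>i. Q (- i)) (\<lambda>i. P (- i)) (1 - t) (- r)"
proof (rule band_map_cases[OF t, of r])
  fix k f assume r: "r = of_int k + f" "0 \<le> f" "f \<le> 1 - t" "f < 1"
  have r': "- r = of_int (- k - 1) + (1 - f)" by (simp add: r)
  have 1: "band_map P Q t r = (1 - t - f) *\<^sub>R P k + f *\<^sub>R P (k + 1) + t *\<^sub>R Q k"
    unfolding r(1) using t r by (intro band_map_lower)
  show ?thesis unfolding 1 r' using t r by (subst band_map_upper) (auto simp: algebra_simps)
next
  fix k f assume r: "r = of_int k + f" "1 - t < f" "f < 1"
  have r': "- r = of_int (- k - 1) + (1 - f)" by (simp add: r)
  have 1: "band_map P Q t r = (1 - t) *\<^sub>R P (k + 1) + (1 - f) *\<^sub>R Q k + (f + t - 1) *\<^sub>R Q (k + 1)"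
    unfolding r(1) using t r by (intro band_map_upper) auto
  show ?thesis unfolding 1 r' using t r by (subst band_map_lower) (auto simp: algebra_simps)
qed

text \<open>
Traversing a slice backwards exchanges the ends of the lower sides, so the parameter is reflected at
the middle of such a side.
\<close>

lemma band_map_reverse:
  assumes t: "0 \<le> t" "t \<le> 1"
  shows "band_map P Q t r = band_map (\<lambda>i. P (- i)) (\<lambda>i. Q (- i - 1)) t (- r - t)"
proof (rule band_map_cases[OF t, of r])
  fix k f assume r: "r = of_int k + f" "0 \<le> f" "f \<le> 1 - t" "f < 1"
  have r': "- r - t = of_int (- k - 1) + (1 - t - f)" by (simp add: r)
  have 1: "band_map P Q t r = (1 - t - f) *\<^sub>R P k + f *\<^sub>R P (k + 1) + t *\<^sub>R Q k"
    unfolding r(1) using t r by (intro band_map_lower)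
  show ?thesis unfolding 1 r' using t r by (subst band_map_lower) (auto simp: algebra_simps)
next
  fix k f assume r: "r = of_int k + f" "1 - t < f" "f < 1"
  have r': "- r - t = of_int (- k - 2) + (2 - t - f)" by (simp add: r)
  have 1: "band_map P Q t r = (1 - t) *\<^sub>R P (k + 1) + (1 - f) *\<^sub>R Q k + (f + t - 1) *\<^sub>R Q (k + 1)"
    unfolding r(1) using t r by (intro band_map_upper) auto
  show ?thesis unfolding 1 r' using t r by (subst band_map_upper) (auto simp: algebra_simps)
qed

lemma cnj_band_map: "cnj (band_map P Q t r) = band_map (\<lambda>i. cnj (P i)) (\<lambda>i. cnj (Q i)) t r"
  by (simp add: band_map_def Let_def)

lemma cos_diff_minus_cos_add: "cos (a - b) - cos (a + b) = 2 * sin a * sin (b :: real)"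
  by (simp add: cos_diff cos_add)

lemma cos_less_of_between:
  fixes a x :: real
  assumes "0 \<le> a" "a < x" "x < 2 * pi - a"
  shows "cos x < cos a"
proof (cases "x \<le> pi")
  case True then show ?thesis using assms by (intro cos_monotone_0_pi) auto
next
  case False
  then have "cos (2 * pi - x) < cos a" using assms by (intro cos_monotone_0_pi) auto
  then show ?thesis by (simp add: cos_diff)
qed

lemma reduce_angle: "\<exists>m::int. \<bar>b - 2 * pi * of_int m\<bar> \<le> pi"
proof -
  have "\<bar>b / (2 * pi) - of_int (round (b / (2 * pi)))\<bar> \<le> 1 / 2"
    using of_int_round_abs_le[of "b / (2 * pi)"] by (simp add: abs_minus_commute)
  then have "\<bar>b / (2 * pi) - of_int (round (b / (2 * pi)))\<bar> * (2 * pi) \<le> 1 / 2 * (2 * pi)"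
    by (intro mult_right_mono) auto
  also have "\<bar>b / (2 * pi) - of_int (round (b / (2 * pi)))\<bar> * (2 * pi)
      = \<bar>(b / (2 * pi) - of_int (round (b / (2 * pi)))) * (2 * pi)\<bar>"
    by (simp add: abs_mult)
  also have "(b / (2 * pi) - of_int (round (b / (2 * pi)))) * (2 * pi)
      = b - 2 * pi * of_int (round (b / (2 * pi)))"
    by (simp only: left_diff_distrib) simp
  finally show ?thesis
    by (intro exI[of _ "round (b / (2 * pi))"]) simp
qed

text \<open>
The set where \<open>cos\<close> is at least \<open>D\<close> is, modulo \<open>2 \<pi>\<close>, an arc around \<open>0\<close>. A point of the
arc whose predecessor at distance \<open>2 \<mu>\<close> is outside lies in the first \<open>2 \<mu>\<close> of the arc.
\<close>

lemma arc_entry: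
  fixes b D \<mu> :: real
  assumes "\<mu> > 0" "0 < D" "D \<le> 1" "cos b \<ge> D" "cos (b - 2 * \<mu>) < D"
  shows "\<exists>m::int. - arccos D \<le> b - 2 * pi * of_int m \<and> b - 2 * pi * of_int m < - arccos D + 2 * \<mu>"
proof -
  obtain m :: int where m: "\<bar>b - 2 * pi * of_int m\<bar> \<le> pi" using reduce_angle by blast
  define c where "c = b - 2 * pi * of_int m"
  have cosc: "cos c = cos b" "cos (c - 2 * \<mu>) = cos (b - 2 * \<mu>)"
  proof -
    have "cos (x - 2 * pi * of_int m) = cos x" for x
      unfolding cos_diff by simp
    from this[of b] this[of "b - 2 * \<mu>"]
    show "cos c = cos b" "cos (c - 2 * \<mu>) = cos (b - 2 * \<mu>)" by (simp_all add: c_def algebra_simps)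
  qed
  have g: "0 \<le> arccos D" "arccos D \<le> pi" "cos (arccos D) = D"
    using assms by (auto intro: arccos_lbound arccos_ubound)
  have le: "\<bar>x\<bar> \<le> arccos D \<longleftrightarrow> cos x \<ge> D" if "\<bar>x\<bar> \<le> pi" for x
    using cos_mono_le_eq[of "arccos D" "\<bar>x\<bar>"] g that by simp
  have 1: "\<bar>c\<bar> \<le> arccos D" using le[of c] m cosc assms by (simp add: c_def)
  have "c - 2 * \<mu> < - arccos D"
  proof (rule ccontr)
    assume "\<not> c - 2 * \<mu> < - arccos D"
    then have 2: "\<bar>c - 2 * \<mu>\<bar> \<le> arccos D" using 1 assms(1) by auto
    then have "\<bar>c - 2 * \<mu>\<bar> \<le> pi" using g by simp
    then show False using le[of "c - 2 * \<mu>"] 2 cosc assms by simp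
  qed
  then show ?thesis using 1 by (intro exI[of _ m]) (auto simp: c_def)
qed

locale regular_polygon =
  fixes n :: nat
  assumes n: "n \<ge> 4"
begin

definition \<mu> :: real where "\<mu> = pi / n"

definition corner :: "real \<Rightarrow> int \<Rightarrow> complex" where
  "corner \<alpha> i = cis (\<alpha> + 2 * \<mu> * of_int i)"

text \<open>
Multiplication by this unit turns the outer normal of the \<open>k\<close>-th side of the polygon into the
positive real axis; the real part is then the distance from the axis in the direction of this normal.
\<close>

definition side_frame :: "real \<Rightarrow> int \<Rightarrow> complex" where
  "side_frame \<alpha> k = cis (- (\<alpha> + \<mu> + 2 * \<mu> * of_int k))"

lemma mu: "\<mu> > 0" "\<mu> \<le> pi / 4" "\<mu> * n = pi"
  using n by (auto simp: \<mu>_def field_simps)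

lemma mu_trig: "0 < sin \<mu>" "0 < cos \<mu>" "cos \<mu> < 1"
proof -
  show "0 < sin \<mu>" "0 < cos \<mu>" using mu by (auto intro!: sin_gt_zero cos_gt_zero)
  show "cos \<mu> < 1" using cos_monotone_0_pi[of 0 \<mu>] mu by auto
qed

text \<open>
Seen from a point outside a regular polygon, the visible sides form one contiguous arc, and this arc has
a unique first side. This assigns to the point an index modulo \<open>n\<close>.
\<close>

lemma index_unique:
  assumes d: "d > 0" and k: "Re (p * side_frame \<alpha> k) \<ge> d" "Re (p * side_frame \<alpha> (k - 1)) < d"
    and l: "Re (p * side_frame \<alpha> l) \<ge> d" "Re (p * side_frame \<alpha> (l - 1)) < d"
  shows "\<exists>m. k - l = m * int n"
proof -
  define \<rho> where "\<rho> = cmod p"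
  define \<eta> where "\<eta> = Arg p"
  have "p \<noteq> 0" using k(1) d by auto
  then have \<rho>: "\<rho> > 0" by (simp add: \<rho>_def)
  have p: "p = of_real \<rho> * cis \<eta>"
    using \<open>p \<noteq> 0\<close> by (simp add: \<rho>_def \<eta>_def rcis_cmod_Arg flip: rcis_def)
  have Re: "Re (p * side_frame \<alpha> j) = \<rho> * cos (\<alpha> + \<mu> + 2 * \<mu> * of_int j - \<eta>)" for j
  proof -
    have "p * side_frame \<alpha> j = of_real \<rho> * cis (- (\<alpha> + \<mu> + 2 * \<mu> * of_int j - \<eta>))"
      by (simp add: p side_frame_def cis_mult mult.assoc algebra_simps)
    then show ?thesis by (simp del: minus_diff_eq)
  qed
  define D where "D = d / \<rho>"
  have D: "D > 0" using d \<rho> by (simp add: D_def)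
  have "\<rho> * cos (\<alpha> + \<mu> + 2 * \<mu> * of_int k - \<eta>) \<le> \<rho> * 1"
    using \<rho> by (intro mult_left_mono) auto
  then have "d \<le> \<rho>" using k(1)[unfolded Re] by linarith
  then have D1: "D \<le> 1" using \<rho> by (simp add: D_def)
  have ent: "\<exists>m::int. - arccos D \<le> (\<alpha> + \<mu> + 2 * \<mu> * of_int j - \<eta>) - 2 * pi * of_int m \<and>
      (\<alpha> + \<mu> + 2 * \<mu> * of_int j - \<eta>) - 2 * pi * of_int m < - arccos D + 2 * \<mu>"
    if "Re (p * side_frame \<alpha> j) \<ge> d" "Re (p * side_frame \<alpha> (j - 1)) < d" for j
  proof (rule arc_entry[OF mu(1) D D1])
    show "D \<le> cos (\<alpha> + \<mu> + 2 * \<mu> * of_int j - \<eta>)"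
      using that(1)[unfolded Re] \<rho> by (simp add: D_def field_simps)
    have "\<alpha> + \<mu> + 2 * \<mu> * of_int (j - 1) - \<eta> = \<alpha> + \<mu> + 2 * \<mu> * of_int j - \<eta> - 2 * \<mu>"
      by (simp add: algebra_simps)
    then show "cos (\<alpha> + \<mu> + 2 * \<mu> * of_int j - \<eta> - 2 * \<mu>) < D"
      using that(2) \<rho> unfolding Re by (simp add: D_def field_simps)
  qed
  obtain m m' :: int where
    "- arccos D \<le> (\<alpha> + \<mu> + 2 * \<mu> * of_int k - \<eta>) - 2 * pi * of_int m"
    "(\<alpha> + \<mu> + 2 * \<mu> * of_int k - \<eta>) - 2 * pi * of_int m < - arccos D + 2 * \<mu>"
    "- arccos D \<le> (\<alpha> + \<mu> + 2 * \<mu> * of_int l - \<eta>) - 2 * pi * of_int m'"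
    "(\<alpha> + \<mu> + 2 * \<mu> * of_int l - \<eta>) - 2 * pi * of_int m' < - arccos D + 2 * \<mu>"
    using ent[OF k] ent[OF l] by blast
  then have "\<bar>(2 * \<mu> * of_int k - 2 * pi * of_int m) - (2 * \<mu> * of_int l - 2 * pi * of_int m')\<bar> < 2 * \<mu>"
    by linarith
  also have "(2 * \<mu> * of_int k - 2 * pi * of_int m) - (2 * \<mu> * of_int l - 2 * pi * of_int m')
      = 2 * \<mu> * of_int (k - l - (m - m') * int n)"
    unfolding mu(3)[symmetric] by (simp add: algebra_simps)
  finally have "2 * \<mu> * \<bar>real_of_int (k - l - (m - m') * int n)\<bar> < 2 * \<mu> * 1"
    using mu(1) by (simp only: abs_mult)
  then have "\<bar>real_of_int (k - l - (m - m') * int n)\<bar> < 1"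
    using mu(1) by (simp only: mult_less_cancel_left_pos)
  then have "\<bar>k - l - (m - m') * int n\<bar> < 1"
    by (metis of_int_abs of_int_less_1_iff)
  then show ?thesis by (intro exI[of _ "m - m'"]) simp
qed

text \<open>
The slice at level \<open>t\<close> of the band of angle \<open>\<theta>\<close> that starts at the polygon with phase \<open>\<alpha>\<close>.
The upper polygon is turned by \<open>\<theta> + \<mu>\<close>, since \<open>\<theta>\<close> is measured from the midpoint of a side and \<open>\<alpha>\<close> at a
corner.
\<close>

abbreviation slice :: "real \<Rightarrow> real \<Rightarrow> real \<Rightarrow> real \<Rightarrow> complex" where
  "slice \<alpha> \<theta> t r \<equiv> band_map (corner \<alpha>) (corner (\<alpha> + \<theta> + \<mu>)) t r"

text \<open>
The period is cut so that it starts with an upper side and ends with a lower one, because for the points of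
such a pair of sides the visible arc has the same first side.
\<close>

lemma slice_index:
  fixes r t :: real
  assumes "0 \<le> t" "t \<le> 1"
  obtains k f where "r = of_int k + f" "- t < f" "f \<le> 1 - t"
proof
  let ?k = "\<lceil>r + t\<rceil> - 1"
  show "r = of_int ?k + (r - of_int ?k)" by simp
  show "- t < r - of_int ?k" "r - of_int ?k \<le> 1 - t" by linarith+
qed

lemma slice_pos:
  assumes "0 \<le> t" "0 \<le> f" "f \<le> 1 - t"
  shows "slice \<alpha> \<theta> t (of_int k + f) * side_frame \<alpha> k =
    of_real (1 - t - f) * cis (- \<mu>) + of_real f * cis \<mu> + of_real t * cis \<theta>"
  unfolding band_map_lower[OF assms] corner_def side_frame_def
  by (simp add: scaleR_conv_of_real distrib_right mult.assoc cis_mult) (simp add: algebra_simps)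

lemma slice_neg:
  assumes "t \<le> 1" "- t \<le> f" "f \<le> 0"
  shows "slice \<alpha> \<theta> t (of_int k + f) * side_frame \<alpha> k =
    of_real (1 - t) * cis (- \<mu>) + of_real (- f) * cis (\<theta> - 2 * \<mu>) + of_real (f + t) * cis \<theta>"
proof -
  have e: "of_int k + f = of_int (k - 1) + (f + 1)" by simp
  show ?thesis
    unfolding e using assms
    by (subst band_map_upper) (auto simp: corner_def side_frame_def scaleR_conv_of_real distrib_right mult.assoc
        cis_mult algebra_simps)
qed

lemma side_frame_pred: "side_frame \<alpha> (k - 1) = side_frame \<alpha> k * cis (2 * \<mu>)"
  by (simp add: side_frame_def cis_mult algebra_simps)

text \<open>
The lower sides of a slice lie on the sides, prolonged, of a regular polygon with inradius \<open>d\<close>, as in a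
pinwheel: each starts at or beyond the corner before it and ends at or beyond the corner after it.
The upper sides lead back from the end of one lower side to the start of the next one and stay outside the
polygon. So the \<open>k\<close>-th pair of sides consists of points for which \<open>k\<close> is the first visible side.
\<close>

lemma slice_enters:
  assumes \<theta>: "\<mu> \<le> \<theta>" "\<theta> < pi - \<mu>" and t: "0 \<le> t" "t < 1"
    and d: "d = (1 - t) * cos \<mu> + t * cos \<theta>" and f: "- t < f" "f \<le> 1 - t"
  shows "Re (slice \<alpha> \<theta> t (of_int k + f) * side_frame \<alpha> k) \<ge> d"
    "Re (slice \<alpha> \<theta> t (of_int k + f) * side_frame \<alpha> (k - 1)) < d"
proof -
  define q where "q = slice \<alpha> \<theta> t (of_int k + f) * side_frame \<alpha> k"
  have s1: "sin (\<theta> + \<mu>) > 0" using \<theta> mu by (intro sin_gt_zero) auto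
  have s2: "sin (\<theta> - \<mu>) \<ge> 0" using \<theta> mu by (intro sin_ge_zero) auto
  have pred: "slice \<alpha> \<theta> t (of_int k + f) * side_frame \<alpha> (k - 1) = q * cis (2 * \<mu>)"
    by (simp add: q_def side_frame_pred mult.assoc)
  have "Re q \<ge> d \<and> Re (q * cis (2 * \<mu>)) < d"
  proof (cases "f > 0")
    case True
    then have q: "q = of_real (1 - t - f) * cis (- \<mu>) + of_real f * cis \<mu> + of_real t * cis \<theta>"
      unfolding q_def using f t by (intro slice_pos) auto
    have re: "Re q = d" unfolding q by (simp add: d algebra_simps)
    have im: "Im q = (2 * f - (1 - t)) * sin \<mu> + t * sin \<theta>" unfolding q by (simp add: algebra_simps)
    have "d * sin \<mu> + Im q * cos \<mu> = 2 * f * (sin \<mu> * cos \<mu>) + t * sin (\<theta> + \<mu>)"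
      unfolding im d by (simp add: sin_add algebra_simps)
    also have "\<dots> > 0" using True mu_trig t s1 by (intro add_pos_nonneg) auto
    finally have *: "0 < 2 * sin \<mu> * (d * sin \<mu> + Im q * cos \<mu>)" using mu_trig by simp
    have "Re (q * cis (2 * \<mu>)) = d * cos (2 * \<mu>) - Im q * sin (2 * \<mu>)" using re by simp
    also have "\<dots> = d - 2 * sin \<mu> * (d * sin \<mu> + Im q * cos \<mu>)"
      unfolding sin_double cos_double_sin by (simp add: power2_eq_square algebra_simps)
    finally show ?thesis using re * by simp
  next
    case False
    then have q: "q = of_real (1 - t) * cis (- \<mu>) + of_real (- f) * cis (\<theta> - 2 * \<mu>) + of_real (f + t) * cis \<theta>"
      unfolding q_def using f t by (intro slice_neg) auto
    have "Re q - d = (- f) * (cos (\<theta> - 2 * \<mu>) - cos \<theta>)" unfolding q d by (simp add: algebra_simps)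
    also have "\<dots> = (- f) * (2 * sin (\<theta> - \<mu>) * sin \<mu>)"
      using cos_diff_minus_cos_add[of "\<theta> - \<mu>" \<mu>] by simp
    also have "\<dots> \<ge> 0" using False s2 mu_trig by (intro mult_nonneg_nonneg) auto
    finally have 1: "Re q \<ge> d" by simp
    have q': "q * cis (2 * \<mu>) = of_real (1 - t) * cis \<mu> + of_real (- f) * cis \<theta> + of_real (f + t) * cis (\<theta> + 2 * \<mu>)"
      unfolding q by (simp only: distrib_right mult.assoc cis_mult) simp
    have "d - Re (q * cis (2 * \<mu>)) = (f + t) * (cos \<theta> - cos (\<theta> + 2 * \<mu>))"
      unfolding q' d by (simp add: algebra_simps)
    also have "\<dots> = (f + t) * (2 * sin (\<theta> + \<mu>) * sin \<mu>)"
      using cos_diff_minus_cos_add[of "\<theta> + \<mu>" \<mu>] by (simp add: add.assoc)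
    also have "\<dots> > 0" using f s1 mu_trig by simp
    finally show ?thesis using 1 by simp
  qed
  then show "Re (slice \<alpha> \<theta> t (of_int k + f) * side_frame \<alpha> k) \<ge> d" "Re (slice \<alpha> \<theta> t (of_int k + f) * side_frame \<alpha> (k - 1)) < d"
    unfolding pred unfolding q_def[symmetric] by auto
qed

lemma corner_periodic: "corner \<alpha> (i + int n * m) = corner \<alpha> i"
proof -
  have "\<alpha> + 2 * \<mu> * of_int (i + int n * m) = (\<alpha> + 2 * \<mu> * of_int i) + 2 * pi * of_int m"
    unfolding mu(3)[symmetric] by (simp add: algebra_simps)
  then show ?thesis unfolding corner_def by (simp only: cis_mult[symmetric]) simp
qed

lemma slice_periodic: "slice \<alpha> \<theta> t (r + of_int (int n * m)) = slice \<alpha> \<theta> t r"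
  by (simp only: band_map_shift corner_periodic)

text \<open>
Along the upper side the distance in the normal direction \<open>k\<close> decreases to \<open>d\<close>, and along the
lower side it is constant while the tangential coordinate increases. For \<open>\<theta> = \<mu>\<close> it is constant on both and
the tangential coordinate alone separates them.
\<close>

lemma slice_inj_index:
  assumes \<theta>: "\<mu> \<le> \<theta>" "\<theta> < pi - \<mu>" and t: "0 \<le> t" "t < 1"
    and f: "- t < f" "f \<le> 1 - t" and f': "- t < f'" "f' \<le> 1 - t"
    and eq: "slice \<alpha> \<theta> t (of_int k + f) = slice \<alpha> \<theta> t (of_int k + f')"
  shows "f = f'"
proof -
  define q where "q = (\<lambda>f. slice \<alpha> \<theta> t (of_int k + f) * side_frame \<alpha> k)"
  have pos: "q f = of_real (1 - t - f) * cis (- \<mu>) + of_real f * cis \<mu> + of_real t * cis \<theta>"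
    if "0 \<le> f" "f \<le> 1 - t" for f unfolding q_def using that t by (intro slice_pos) auto
  have neg: "q f = of_real (1 - t) * cis (- \<mu>) + of_real (- f) * cis (\<theta> - 2 * \<mu>) + of_real (f + t) * cis \<theta>"
    if "- t \<le> f" "f \<le> 0" for f unfolding q_def using that t by (intro slice_neg) auto
  have s1: "sin (\<theta> - \<mu>) \<ge> 0" using \<theta> mu by (intro sin_ge_zero) auto
  have mixed: False
    if f: "0 < f" "f \<le> 1 - t" and g: "- t < g" "g \<le> 0" and eq: "q f = q g" for f g
  proof -
    have "Re (q f) = Re (q g)" "Im (q f) = Im (q g)" by (simp_all only: eq)
    then have re: "(1 - t) * cos \<mu> + t * cos \<theta> = (1 - t) * cos \<mu> + (- g) * cos (\<theta> - 2 * \<mu>) + (g + t) * cos \<theta>"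
      and im: "(2 * f - (1 - t)) * sin \<mu> + t * sin \<theta> = - (1 - t) * sin \<mu> + (- g) * sin (\<theta> - 2 * \<mu>) + (g + t) * sin \<theta>"
      using pos[of f] neg[of g] f g by (simp_all add: algebra_simps)
    have "g * (cos (\<theta> - 2 * \<mu>) - cos \<theta>) = 0" using re by (simp add: algebra_simps)
    moreover have "cos (\<theta> - 2 * \<mu>) - cos \<theta> = 2 * sin (\<theta> - \<mu>) * sin \<mu>"
      using cos_diff_minus_cos_add[of "\<theta> - \<mu>" \<mu>] by simp
    ultimately have "g * (2 * sin (\<theta> - \<mu>) * sin \<mu>) = 0" by (simp only:)
    then consider "g = 0" | "sin (\<theta> - \<mu>) = 0" using mu_trig by auto
    then show False
    proof cases
      case 1 then show False using im f mu_trig by (simp add: algebra_simps)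
    next
      case 2
      have "\<theta> = \<mu>"
      proof (rule ccontr)
        assume "\<theta> \<noteq> \<mu>"
        then have "sin (\<theta> - \<mu>) > 0" using \<theta> mu by (intro sin_gt_zero) auto
        then show False using 2 by simp
      qed
      then have "(2 * f - 2 * g) * sin \<mu> = 0" using im by (simp add: algebra_simps)
      then show False using f g mu_trig by simp
    qed
  qed
  have eq': "q f = q f'" using eq by (simp add: q_def)
  consider "f > 0" "f' > 0" | "f > 0" "f' \<le> 0" | "f \<le> 0" "f' > 0" | "f \<le> 0" "f' \<le> 0" by linarith
  then show ?thesis
  proof cases
    case 1
    have "Im (q f) = Im (q f')" using eq' by simp
    then have "2 * (f - f') * sin \<mu> = 0" using pos[of f] pos[of f'] 1 f f' by (simp add: algebra_simps)
    then show ?thesis using mu_trig by simp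
  next
    case 2 then show ?thesis using mixed[of f f'] f f' eq' by simp
  next
    case 3 then show ?thesis using mixed[of f' f] f f' eq' by simp
  next
    case 4
    then have "of_real (f' - f) * (cis (\<theta> - 2 * \<mu>) - cis \<theta>) = 0"
      using eq' neg[of f] neg[of f'] f f' by (simp add: algebra_simps)
    moreover have "cis (\<theta> - 2 * \<mu>) \<noteq> cis \<theta>"
    proof
      assume *: "cis (\<theta> - 2 * \<mu>) = cis \<theta>"
      have "cis (- (2 * \<mu>)) = cis (\<theta> - 2 * \<mu>) * cis (- \<theta>)" by (simp only: cis_mult) simp
      also have "\<dots> = 1" unfolding * by (simp only: cis_mult) simp
      finally have "sin (2 * \<mu>) = 0" by (simp add: complex_eq_iff)
      then show False using mu_trig by (simp add: sin_double)
    qed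
    ultimately show ?thesis by simp
  qed
qed

text \<open>
The hypothesis on \<open>d\<close> says that the pinwheel polygon formed by the lower sides is not degenerate.
\<close>

lemma slice_inj_star:
  assumes \<theta>: "\<mu> \<le> \<theta>" "\<theta> < pi - \<mu>" and t: "0 \<le> t" "t < 1"
    and d: "(1 - t) * cos \<mu> + t * cos \<theta> > 0"
    and eq: "slice \<alpha> \<theta> t r = slice \<alpha> \<theta> t r'"
  shows "\<exists>m. r - r' = of_int m * real n"
proof -
  obtain k f where r: "r = of_int k + f" "- t < f" "f \<le> 1 - t"
    using slice_index[of t r] t by auto
  obtain k' f' where r': "r' = of_int k' + f'" "- t < f'" "f' \<le> 1 - t"
    using slice_index[of t r'] t by auto
  note enters = slice_enters[OF \<theta> t refl r(2,3), of \<alpha> k, folded r(1)]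
    slice_enters[OF \<theta> t refl r'(2,3), of \<alpha> k', folded r'(1), folded eq]
  obtain m where m: "k - k' = m * int n"
    using index_unique[OF d enters] by blast
  then have k: "k = k' + int n * m" by (simp add: algebra_simps)
  have "slice \<alpha> \<theta> t (of_int k' + f + of_int (int n * m)) = slice \<alpha> \<theta> t (of_int k' + f')"
    using eq unfolding r(1) r'(1) k by (simp add: algebra_simps)
  then have "slice \<alpha> \<theta> t (of_int k' + f) = slice \<alpha> \<theta> t (of_int k' + f')"
    by (simp only: slice_periodic)
  then have "f = f'" by (rule slice_inj_index[OF \<theta> t r(2,3) r'(2,3)])
  then show ?thesis using r r' k by (intro exI[of _ m]) simp
qed

lemma cnj_corner: "cnj (corner \<alpha> (- i)) = corner (- \<alpha>) i"
  by (simp add: corner_def cis_cnj)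

lemma slice_flip:
  assumes "0 \<le> t" "t \<le> 1"
  shows "cnj (slice \<alpha> \<theta> t r) = slice (- (\<alpha> + \<theta> + \<mu>)) \<theta> (1 - t) (- r)"
  by (subst band_map_flip[OF assms]) (simp add: cnj_band_map cnj_corner)

lemma slice_reverse:
  assumes "0 \<le> t" "t \<le> 1"
  shows "cnj (slice \<alpha> \<theta> t r) = slice (- \<alpha>) (- \<theta>) t (- r - t)"
proof -
  have "cnj (corner (\<alpha> + \<theta> + \<mu>) (- i - 1)) = corner (- \<alpha> + - \<theta> + \<mu>) i" for i
    by (simp add: corner_def cis_cnj algebra_simps)
  then show ?thesis
    by (subst band_map_reverse[OF assms]) (simp add: cnj_band_map cnj_corner)
qed

text \<open>
The inradii of the pinwheel polygons of the lower and of the upper sides add up to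
\<open>cos \<mu> + cos \<theta> > 0\<close>, so one of them is positive. If it is not the lower one, the band is turned
upside down.
\<close>

lemma slice_inj_pos:
  assumes \<theta>: "\<mu> \<le> \<theta>" "\<theta> < pi - \<mu>" and t: "0 \<le> t" "t \<le> 1"
    and eq: "slice \<alpha> \<theta> t r = slice \<alpha> \<theta> t r'"
  shows "\<exists>m. r - r' = of_int m * real n"
proof (cases "t < 1 \<and> (1 - t) * cos \<mu> + t * cos \<theta> > 0")
  case True then show ?thesis using slice_inj_star[OF \<theta>] t eq by blast
next
  case False
  have "cos (pi - \<mu>) < cos \<theta>" using \<theta> mu by (intro cos_monotone_0_pi) auto
  then have c: "cos \<mu> + cos \<theta> > 0" by (simp add: cos_diff)
  have t1: "1 - t < 1" using False mu_trig t by (cases "t = 0") auto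
  have d: "(1 - (1 - t)) * cos \<mu> + (1 - t) * cos \<theta> > 0"
  proof (cases "t = 1")
    case True then show ?thesis using mu_trig by simp
  next
    case ne: False
    have "(1 - (1 - t)) * cos \<mu> + (1 - t) * cos \<theta>
      = (cos \<mu> + cos \<theta>) - ((1 - t) * cos \<mu> + t * cos \<theta>)" by (simp add: algebra_simps)
    then show ?thesis using c False ne t by auto
  qed
  have eq': "slice (- (\<alpha> + \<theta> + \<mu>)) \<theta> (1 - t) (- r) = slice (- (\<alpha> + \<theta> + \<mu>)) \<theta> (1 - t) (- r')"
    unfolding slice_flip[OF t, symmetric] eq ..
  have "0 \<le> 1 - t" using t by simp
  from slice_inj_star[OF \<theta> this t1 d eq'] obtain m where "- r - (- r') = of_int m * real n" ..
  then show ?thesis by (intro exI[of _ "- m"]) simp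
qed

text \<open>
Reflecting a slice in a plane through the axis changes the sign of the angle.
\<close>

theorem slice_inj:
  assumes \<theta>: "\<mu> \<le> \<bar>\<theta>\<bar>" "\<bar>\<theta>\<bar> < pi - \<mu>" and t: "0 \<le> t" "t \<le> 1"
    and eq: "slice \<alpha> \<theta> t r = slice \<alpha> \<theta> t r'"
  shows "\<exists>m. r - r' = of_int m * real n"
proof (cases "\<theta> \<ge> 0")
  case True then show ?thesis using slice_inj_pos[OF _ _ t eq] \<theta> by simp
next
  case False
  have eq': "slice (- \<alpha>) (- \<theta>) t (- r - t) = slice (- \<alpha>) (- \<theta>) t (- r' - t)"
    unfolding slice_reverse[OF t, symmetric] eq ..
  have "\<mu> \<le> - \<theta>" "- \<theta> < pi - \<mu>" using \<theta> False by auto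
  from slice_inj_pos[OF this t eq'] obtain m where "(- r - t) - (- r' - t) = of_int m * real n" ..
  then show ?thesis by (intro exI[of _ "- m"]) simp
qed

end

section \<open>Separation of nested bands\<close>

context regular_polygon begin

lemma norm_side_frame: "cmod (z * side_frame \<alpha> k) = cmod z"
  by (simp add: norm_mult side_frame_def)

text \<open>
For \<open>\<theta> = \<mu>\<close> each apex lies over an end of its side, so all slices are the same regular polygon.
\<close>

lemma prism_slice:
  assumes "0 \<le> t" "t < 1"
  shows "\<exists>k. Re (slice \<alpha> \<mu> t r * side_frame \<alpha> k) = cos \<mu>"
proof -
  obtain k f where r: "r = of_int k + f" "- t < f" "f \<le> 1 - t"
    using slice_index[of t r] assms by auto
  have "Re (slice \<alpha> \<mu> t r * side_frame \<alpha> k) = cos \<mu>"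
  proof (cases "f \<ge> 0")
    case True
    show ?thesis unfolding r(1) using True r assms by (subst slice_pos) (auto simp: algebra_simps)
  next
    case False
    show ?thesis unfolding r(1) using False r assms by (subst slice_neg) (auto simp: algebra_simps)
  qed
  then show ?thesis by blast
qed

lemma cis_sum_norm_ge:
  assumes w: "0 \<le> a" "0 \<le> b" "0 \<le> c" "a + b + c = 1"
    and ang: "\<bar>x - e\<bar> \<le> h" "\<bar>y - e\<bar> \<le> h" "\<bar>z - e\<bar> \<le> h" "h \<le> pi"
  shows "cmod (of_real a * cis x + of_real b * cis y + of_real c * cis z) \<ge> cos h"
proof -
  have c: "cos (u - e) \<ge> cos h" if "\<bar>u - e\<bar> \<le> h" for u
    using cos_mono_le_eq[of "h" "\<bar>u - e\<bar>"] that ang(4) by auto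
  have "cos h = a * cos h + b * cos h + c * cos h" using w(4) by (metis distrib_right mult_1)
  also have "\<dots> \<le> a * cos (x - e) + b * cos (y - e) + c * cos (z - e)"
    using w ang c by (intro add_mono mult_left_mono) auto
  also have "\<dots> = Re ((of_real a * cis x + of_real b * cis y + of_real c * cis z) * cis (- e))"
    by (simp add: distrib_right mult.assoc cis_mult)
  also have "\<dots> \<le> cmod ((of_real a * cis x + of_real b * cis y + of_real c * cis z) * cis (- e))"
    by (rule complex_Re_le_cmod)
  finally show ?thesis by (simp add: norm_mult)
qed

text \<open>
The directions of the three corners of a triangle of the band lie in an arc of length \<open>\<phi> + \<mu>\<close>. In the
direction of the middle of the arc all of them have distance at least \<open>cos ((\<phi> + \<mu>) / 2)\<close> from the axis.
\<close>

lemma slice_norm_ge_pos: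
  assumes \<phi>: "\<mu> \<le> \<phi>" "\<phi> < pi - \<mu>" and t: "0 \<le> t" "t < 1"
  shows "cmod (slice \<alpha> \<phi> t r) \<ge> cos ((\<phi> + \<mu>) / 2)"
proof -
  obtain k f where r: "r = of_int k + f" "- t < f" "f \<le> 1 - t"
    using slice_index[of t r] t by auto
  let ?e = "(\<phi> - \<mu>) / 2"
  have "cmod (slice \<alpha> \<phi> t r * side_frame \<alpha> k) \<ge> cos ((\<phi> + \<mu>) / 2)"
  proof (cases "f \<ge> 0")
    case True
    have *: "slice \<alpha> \<phi> t r * side_frame \<alpha> k = of_real (1 - t - f) * cis (- \<mu>) + of_real f * cis \<mu> + of_real t * cis \<phi>"
      unfolding r(1) using True r t by (intro slice_pos) auto
    show ?thesis unfolding * using True r t \<phi> mu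
      by (intro cis_sum_norm_ge[where e = ?e]) (auto simp: abs_le_iff field_simps)
  next
    case False
    have *: "slice \<alpha> \<phi> t r * side_frame \<alpha> k
        = of_real (1 - t) * cis (- \<mu>) + of_real (- f) * cis (\<phi> - 2 * \<mu>) + of_real (f + t) * cis \<phi>"
      unfolding r(1) using False r t by (intro slice_neg) auto
    show ?thesis unfolding * using False r t \<phi> mu
      by (intro cis_sum_norm_ge[where e = ?e]) (auto simp: abs_le_iff field_simps)
  qed
  then show ?thesis by (simp add: norm_side_frame)
qed

lemma slice_norm_ge:
  assumes \<phi>: "\<mu> \<le> \<bar>\<phi>\<bar>" "\<bar>\<phi>\<bar> < pi - \<mu>" and t: "0 \<le> t" "t < 1"
  shows "cmod (slice \<alpha> \<phi> t r) \<ge> cos ((\<bar>\<phi>\<bar> + \<mu>) / 2)"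
proof (cases "\<phi> \<ge> 0")
  case True then show ?thesis using slice_norm_ge_pos[of \<phi> t] \<phi> t by simp
next
  case False
  have "cmod (slice \<alpha> \<phi> t r) = cmod (cnj (slice \<alpha> \<phi> t r))" by simp
  also have "\<dots> = cmod (slice (- \<alpha>) (- \<phi>) t (- r - t))"
    using t by (subst slice_reverse) auto
  also have "\<dots> \<ge> cos ((- \<phi> + \<mu>) / 2)"
    using \<phi> t False by (intro slice_norm_ge_pos) auto
  finally show ?thesis using False by simp
qed

text \<open>
The edges of a band, as seen from above: each joins a corner of one polygon to a corner of the other.
\<close>

definition rail :: "real \<Rightarrow> real \<Rightarrow> real \<Rightarrow> complex" where
  "rail a \<psi> t = of_real (1 - t) * cis a + of_real t * cis (a + \<psi>)"

text \<open>
The corners of a slice lie on the edges between the two polygons, so convex properties need only be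
checked on these edges.
\<close>

lemma slice_in_rails_hull:
  assumes t: "0 < t" "t < 1" and C: "convex C"
    and rails: "\<And>i \<psi>. \<psi> \<in> {\<theta> + \<mu>, \<theta> - \<mu>} \<Longrightarrow> rail (\<alpha> + 2 * \<mu> * of_int i) \<psi> t \<in> C"
  shows "slice \<alpha> \<theta> t r \<in> C"
proof -
  have r01: "rail (\<alpha> + 2 * \<mu> * of_int i) (\<theta> + \<mu>) t = (1 - t) *\<^sub>R corner \<alpha> i + t *\<^sub>R corner (\<alpha> + \<theta> + \<mu>) i" for i
    by (simp add: rail_def corner_def scaleR_conv_of_real algebra_simps)
  have r10: "rail (\<alpha> + 2 * \<mu> * of_int (i + 1)) (\<theta> - \<mu>) t = (1 - t) *\<^sub>R corner \<alpha> (i + 1) + t *\<^sub>R corner (\<alpha> + \<theta> + \<mu>) i" for i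
    by (simp add: rail_def corner_def scaleR_conv_of_real algebra_simps)
  have rails': "(1 - t) *\<^sub>R corner \<alpha> i + t *\<^sub>R corner (\<alpha> + \<theta> + \<mu>) i \<in> C"
    "(1 - t) *\<^sub>R corner \<alpha> (i + 1) + t *\<^sub>R corner (\<alpha> + \<theta> + \<mu>) i \<in> C" for i
    using rails[of "\<theta> + \<mu>" i] rails[of "\<theta> - \<mu>" "i + 1"] unfolding r01 r10 by auto
  from t have t': "0 \<le> t" "t \<le> 1" by auto
  show ?thesis
  proof (rule band_map_cases[OF t', of r])
    fix k f assume r: "r = of_int k + f" "0 \<le> f" "f \<le> 1 - t" "f < 1"
    define w where "w = f / (1 - t)"
    have f: "f = w * (1 - t)" using t by (simp add: w_def)
    have w: "0 \<le> w" "w \<le> 1" using r t by (auto simp: w_def)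
    have "slice \<alpha> \<theta> t r = (1 - t - f) *\<^sub>R corner \<alpha> k + f *\<^sub>R corner \<alpha> (k + 1) + t *\<^sub>R corner (\<alpha> + \<theta> + \<mu>) k"
      unfolding r(1) using t r by (intro band_map_lower) auto
    also have "\<dots> = (1 - w) *\<^sub>R ((1 - t) *\<^sub>R corner \<alpha> k + t *\<^sub>R corner (\<alpha> + \<theta> + \<mu>) k)
        + w *\<^sub>R ((1 - t) *\<^sub>R corner \<alpha> (k + 1) + t *\<^sub>R corner (\<alpha> + \<theta> + \<mu>) k)"
      unfolding f by (simp add: algebra_simps)
    also have "\<dots> \<in> C" using w by (intro convexD[OF C] rails') auto
    finally show ?thesis .
  next
    fix k f assume r: "r = of_int k + f" "1 - t < f" "f < 1"
    define w where "w = (f + t - 1) / t"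
    have f: "f = 1 - t + w * t" using t by (simp add: w_def)
    have w: "0 \<le> w" "w \<le> 1" using r t by (auto simp: w_def)
    have "slice \<alpha> \<theta> t r = (1 - t) *\<^sub>R corner \<alpha> (k + 1) + (1 - f) *\<^sub>R corner (\<alpha> + \<theta> + \<mu>) k
        + (f + t - 1) *\<^sub>R corner (\<alpha> + \<theta> + \<mu>) (k + 1)"
      unfolding r(1) using t r by (intro band_map_upper) auto
    also have "\<dots> = (1 - w) *\<^sub>R ((1 - t) *\<^sub>R corner \<alpha> (k + 1) + t *\<^sub>R corner (\<alpha> + \<theta> + \<mu>) k)
        + w *\<^sub>R ((1 - t) *\<^sub>R corner \<alpha> (k + 1) + t *\<^sub>R corner (\<alpha> + \<theta> + \<mu>) (k + 1))"
      unfolding f by (simp add: algebra_simps)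
    also have "\<dots> \<in> C" using w by (intro convexD[OF C] rails') auto
    finally show ?thesis .
  qed
qed

lemma norm_rail: "(cmod (rail a \<psi> t))\<^sup>2 = 1 - 2 * t * (1 - t) * (1 - cos \<psi>)"
proof -
  have "cmod (rail a \<psi> t) = cmod (cis a * (of_real (1 - t) + of_real t * cis \<psi>))"
    by (simp add: rail_def distrib_left cis_mult[symmetric] mult.commute mult.left_commute)
  then have "(cmod (rail a \<psi> t))\<^sup>2 = (1 - t + t * cos \<psi>)\<^sup>2 + (t * sin \<psi>)\<^sup>2"
    by (simp add: norm_mult cmod_power2)
  also have "\<dots> = 1 - 2 * t * (1 - t) * (1 - cos \<psi>)"
    by (simp add: power_mult_distrib sin_squared_eq) (simp add: power2_eq_square algebra_simps)
  finally show ?thesis .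
qed

lemma slice_norm_le:
  assumes \<theta>: "\<mu> \<le> \<theta>" "\<theta> \<le> pi - \<mu>" and t: "0 < t" "t < 1"
  shows "(cmod (slice \<alpha> \<theta> t r))\<^sup>2 \<le> 1 - 2 * t * (1 - t) * (1 - cos (\<theta> - \<mu>))"
proof -
  let ?R = "1 - 2 * t * (1 - t) * (1 - cos (\<theta> - \<mu>))"
  have R: "?R \<ge> 0" using norm_rail[of 0 "\<theta> - \<mu>" t] zero_le_power2 by metis
  have "slice \<alpha> \<theta> t r \<in> cball 0 (sqrt ?R)"
  proof (rule slice_in_rails_hull[OF t])
    fix i \<psi> assume \<psi>: "\<psi> \<in> {\<theta> + \<mu>, \<theta> - \<mu>}"
    have "cos \<psi> \<le> cos (\<theta> - \<mu>)" using \<psi> \<theta> mu cos_mono_le_eq[of "\<theta> + \<mu>" "\<theta> - \<mu>"] by auto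
    then have "2 * t * (1 - t) * (1 - cos (\<theta> - \<mu>)) \<le> 2 * t * (1 - t) * (1 - cos \<psi>)"
      using t by (intro mult_left_mono) auto
    then have "(cmod (rail (\<alpha> + 2 * \<mu> * of_int i) \<psi> t))\<^sup>2 \<le> ?R" by (simp add: norm_rail)
    then show "rail (\<alpha> + 2 * \<mu> * of_int i) \<psi> t \<in> cball 0 (sqrt ?R)"
      by (simp add: real_le_rsqrt)
  qed simp
  then have "cmod (slice \<alpha> \<theta> t r) \<le> sqrt ?R" by simp
  then show ?thesis using R by (simp add: real_sqrt_ge_0_iff sqrt_ge_absD)
qed

text \<open>
The normals of the sides of a regular polygon make odd multiples of \<open>\<mu>\<close> with the direction of a corner.
Modulo \<open>2 \<pi>\<close> this is \<open>\<plusminus>\<mu>\<close> for the two sides at the corner and at least \<open>3 \<mu>\<close> otherwise.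
\<close>

lemma cos_odd_multiple:
  obtains (one) c where "\<And>x. cos (x - (2 * of_int j + 1) * \<mu>) = cos (x - c)" "\<bar>c\<bar> = \<mu>"
  | (three) c where "\<And>x. cos (x - (2 * of_int j + 1) * \<mu>) = cos (x - c)" "3 * \<mu> \<le> \<bar>c\<bar>" "\<bar>c\<bar> \<le> pi"
proof -
  obtain m :: int where m: "\<bar>(2 * of_int j + 1) * \<mu> - 2 * pi * of_int m\<bar> \<le> pi" using reduce_angle by blast
  define l where "l = j - m * int n"
  have c: "(2 * of_int j + 1) * \<mu> - 2 * pi * of_int m = (2 * of_int l + 1) * \<mu>"
    unfolding mu(3)[symmetric] l_def by (simp add: algebra_simps)
  have cos: "cos (x - (2 * of_int j + 1) * \<mu>) = cos (x - (2 * of_int l + 1) * \<mu>)" for x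
  proof -
    have "x - (2 * of_int l + 1) * \<mu> = (x - (2 * of_int j + 1) * \<mu>) + 2 * pi * of_int m"
      using c by simp
    moreover have "cos (u + 2 * pi * of_int m) = cos u" for u unfolding cos_add by simp
    ultimately show ?thesis by (simp only:)
  qed
  have abs: "\<bar>(2 * of_int l + 1) * \<mu>\<bar> = of_int \<bar>2 * l + 1\<bar> * \<mu>"
    using mu by (simp add: abs_mult)
  consider "l = 0 \<or> l = -1" | "\<bar>2 * l + 1\<bar> \<ge> 3" by linarith
  then show thesis
  proof cases
    case 1
    then have "\<bar>2 * l + 1\<bar> = 1" by auto
    then have "\<bar>(2 * of_int l + 1) * \<mu>\<bar> = \<mu>" unfolding abs by simp
    then show ?thesis by (rule one[OF cos])
  next
    case 2
    then have "real_of_int 3 \<le> of_int \<bar>2 * l + 1\<bar>" by (simp only: of_int_le_iff)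
    then have "3 * \<mu> \<le> \<bar>(2 * of_int l + 1) * \<mu>\<bar>" unfolding abs using mu by (intro mult_right_mono) auto
    moreover have "\<bar>(2 * of_int l + 1) * \<mu>\<bar> \<le> pi" using m unfolding c .
    ultimately show ?thesis by (rule three[OF cos])
  qed
qed

lemma cos_3mu: "1 + cos (3 * \<mu>) < 2 * cos \<mu>"
proof -
  have "cos (pi / 4) \<le> cos \<mu>" using mu by (intro cos_monotone_0_pi_le) auto
  then have c: "1 / 2 < cos \<mu>" using cos_45 by (smt (verit) real_less_rsqrt power_one_over sqrt2_less_2 field_sum_of_halves real_sqrt_gt_1_iff)
  have "(cos \<mu> - 1) * (4 * (cos \<mu>)\<^sup>2 + 4 * cos \<mu> - 1) < 0"
    using mu_trig c by (intro mult_neg_pos) (auto simp: add_pos_pos intro: order.strict_trans2)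
  then have "4 * cos \<mu> ^ 3 - 5 * cos \<mu> + 1 < 0" by (simp add: power2_eq_square power3_eq_cube algebra_simps)
  then show ?thesis unfolding cos_treble_cos by simp
qed

text \<open>
Up to its midpoint an edge of the inner band stays inside all faces of the prism. It leaves the two faces
at its starting corner because it heads for a corner that is strictly behind them, which is where
\<open>\<psi> > 2 \<mu>\<close> enters; it does not reach any other face because its start is at distance at most
\<open>cos (3 \<mu>)\<close> in that direction and it covers at most half of the way to distance \<open>1\<close>.
\<close>

lemma rail_inside_prism:
  assumes \<psi>: "2 * \<mu> < \<psi>" "\<psi> \<le> pi" and t: "0 < t" "t \<le> 1 / 2"
  shows "(1 - t) * cos ((2 * of_int j + 1) * \<mu>) + t * cos (\<psi> - (2 * of_int j + 1) * \<mu>) < cos \<mu>"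
proof -
  have e: "cos ((2 * of_int j + 1) * \<mu>) = cos (0 - (2 * of_int j + 1) * \<mu>)" by simp
  show ?thesis
  proof (rule cos_odd_multiple[of j])
    fix c assume c: "\<And>x. cos (x - (2 * of_int j + 1) * \<mu>) = cos (x - c)" "\<bar>c\<bar> = \<mu>"
    have "cos (\<psi> - c) < cos \<mu>" using c(2) \<psi> mu by (intro cos_less_of_between) (auto simp: abs_if split: if_splits)
    then have "t * cos (\<psi> - c) < t * cos \<mu>" using t by simp
    moreover have "cos (0 - c) = cos \<mu>" unfolding c(2)[symmetric] by simp
    ultimately show ?thesis unfolding e c(1) by (simp add: algebra_simps)
  next
    fix c assume c: "\<And>x. cos (x - (2 * of_int j + 1) * \<mu>) = cos (x - c)" "3 * \<mu> \<le> \<bar>c\<bar>" "\<bar>c\<bar> \<le> pi"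
    have "cos (0 - c) = cos \<bar>c\<bar>" by simp
    also have "\<dots> \<le> cos (3 * \<mu>)" using c mu by (intro cos_monotone_0_pi_le) auto
    finally have "(1 - t) * cos (0 - c) \<le> (1 - t) * cos (3 * \<mu>)" using t by (intro mult_left_mono) auto
    moreover have "t * cos (\<psi> - c) \<le> t * 1" using t by (intro mult_left_mono) auto
    moreover have "t * (1 - cos (3 * \<mu>)) \<le> 1 / 2 * (1 - cos (3 * \<mu>))" using t by (intro mult_right_mono) auto
    ultimately show ?thesis unfolding e c(1) using cos_3mu by (simp add: algebra_simps)
  qed
qed

lemma slice_inside_first_prism:
  assumes \<theta>: "3 * \<mu> < \<theta>" "\<theta> \<le> pi - \<mu>" and t: "0 < t" "t \<le> 1 / 2"
  shows "Re (slice \<alpha> \<theta> t r * side_frame \<alpha> k) < cos \<mu>"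
proof -
  have C: "z \<in> {z. cnj (side_frame \<alpha> k) \<bullet> z < cos \<mu>} \<longleftrightarrow> Re (z * side_frame \<alpha> k) < cos \<mu>" for z
    by (simp add: inner_complex_def algebra_simps)
  have "slice \<alpha> \<theta> t r \<in> {z. cnj (side_frame \<alpha> k) \<bullet> z < cos \<mu>}"
  proof (rule slice_in_rails_hull)
    fix i \<psi> assume \<psi>: "\<psi> \<in> {\<theta> + \<mu>, \<theta> - \<mu>}"
    have "rail (\<alpha> + 2 * \<mu> * of_int i) \<psi> t * side_frame \<alpha> k
      = of_real (1 - t) * cis (- ((2 * of_int (k - i) + 1) * \<mu>)) + of_real t * cis (\<psi> - (2 * of_int (k - i) + 1) * \<mu>)"
      by (simp add: rail_def side_frame_def distrib_right mult.assoc cis_mult algebra_simps)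
    then have "Re (rail (\<alpha> + 2 * \<mu> * of_int i) \<psi> t * side_frame \<alpha> k)
      = (1 - t) * cos ((2 * of_int (k - i) + 1) * \<mu>) + t * cos (\<psi> - (2 * of_int (k - i) + 1) * \<mu>)"
      by simp
    also have "\<dots> < cos \<mu>" using \<psi> \<theta> t mu by (intro rail_inside_prism) auto
    finally show "rail (\<alpha> + 2 * \<mu> * of_int i) \<psi> t \<in> {z. cnj (side_frame \<alpha> k) \<bullet> z < cos \<mu>}"
      unfolding C .
  qed (use t in \<open>auto intro: convex_halfspace_lt\<close>)
  then show ?thesis unfolding C .
qed

lemma slice_inside_last_prism:
  assumes \<theta>: "3 * \<mu> < \<theta>" "\<theta> \<le> pi - \<mu>" and t: "1 / 2 \<le> t" "t < 1"
  shows "Re (slice \<alpha> \<theta> t r * side_frame (\<alpha> + \<theta> + \<mu>) k) < cos \<mu>"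
proof -
  have side_frame: "cnj (side_frame (\<alpha> + \<theta> + \<mu>) k) = side_frame (- (\<alpha> + \<theta> + \<mu>)) (- k - 1)"
    by (simp add: side_frame_def cis_cnj algebra_simps)
  have "Re (slice \<alpha> \<theta> t r * side_frame (\<alpha> + \<theta> + \<mu>) k) = Re (cnj (slice \<alpha> \<theta> t r * side_frame (\<alpha> + \<theta> + \<mu>) k))"
    by (subst cnj.sel(1)) (rule refl)
  also have "cnj (slice \<alpha> \<theta> t r * side_frame (\<alpha> + \<theta> + \<mu>) k)
      = slice (- (\<alpha> + \<theta> + \<mu>)) \<theta> (1 - t) (- r) * side_frame (- (\<alpha> + \<theta> + \<mu>)) (- k - 1)"
    using t by (simp only: complex_cnj_mult side_frame) (subst slice_flip, auto)
  also have "Re \<dots> < cos \<mu>" using t by (intro slice_inside_first_prism \<theta>) auto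
  finally show ?thesis .
qed

end

section \<open>A torus made of five bands\<close>

text \<open>
Space as the product of a horizontal complex plane and a vertical axis.
\<close>

definition vec3 :: "complex \<Rightarrow> real \<Rightarrow> real^3" where
  "vec3 p h = vector [Re p, Im p, h]"

lemma vec3_eq_iff: "vec3 p h = vec3 p' h' \<longleftrightarrow> p = p' \<and> h = h'"
  by (auto simp: vec3_def vec_eq_iff forall_3 complex_eq_iff)

lemma vec3_add: "vec3 p h + vec3 p' h' = vec3 (p + p') (h + h')"
  by (simp add: vec3_def vec_eq_iff forall_3)

lemma vec3_scaleR: "c *\<^sub>R vec3 p h = vec3 (c *\<^sub>R p) (c * h)"
  by (simp add: vec3_def vec_eq_iff forall_3)

lemma dist_vec3: "dist (vec3 p h) (vec3 p' h') = sqrt ((dist p p')\<^sup>2 + (h - h')\<^sup>2)"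
  by (simp add: vec3_def dist_vec_def L2_set_def sum_3 dist_real_def dist_complex_def cmod_power2)

lemma band_map_vec3:
  "band_map (\<lambda>i. vec3 (P i) a) (\<lambda>i. vec3 (Q i) b) t r = vec3 (band_map P Q t r) ((1 - t) * a + t * b)"
  by (simp add: band_map_def Let_def vec3_add vec3_scaleR vec3_eq_iff algebra_simps)

lemma dist_cis: "(dist (cis a) (cis b))\<^sup>2 = 2 - 2 * cos (a - b)"
proof -
  have "(dist (cis a) (cis b))\<^sup>2 = ((cos a)\<^sup>2 + (sin a)\<^sup>2) + ((cos b)\<^sup>2 + (sin b)\<^sup>2) - 2 * (cos a * cos b + sin a * sin b)"
    by (simp only: dist_norm cmod_power2) (simp add: power2_eq_square algebra_simps)
  then show ?thesis by (simp add: cos_diff)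
qed

context regular_polygon begin

lemma dist_corner_next: "dist (corner \<alpha> i) (corner \<alpha> (i + 1)) = 2 * sin \<mu>"
proof -
  have "(dist (corner \<alpha> i) (corner \<alpha> (i + 1)))\<^sup>2 = 2 - 2 * cos (2 * \<mu>)"
    unfolding corner_def dist_cis by (simp add: algebra_simps)
  also have "\<dots> = (2 * sin \<mu>)\<^sup>2" by (simp add: cos_double_sin power_mult_distrib)
  finally have eq: "(dist (corner \<alpha> i) (corner \<alpha> (i + 1)))\<^sup>2 = (2 * sin \<mu>)\<^sup>2" .
  show ?thesis by (rule power2_eq_imp_eq[OF eq]) (use mu_trig in auto)
qed

text \<open>
The two summands are the squares of the tangential and of the normal distance to the line of a side.
The first is the offset of the apex along the side, the second becomes, together with the height in
space, the altitude of the triangle.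
\<close>

lemma dist_corner_same:
  "(dist (corner \<alpha> i) (corner (\<alpha> + \<theta> + \<mu>) i))\<^sup>2 = (sin \<mu> + sin \<theta>)\<^sup>2 + (cos \<mu> - cos \<theta>)\<^sup>2"
proof -
  have "(dist (corner \<alpha> i) (corner (\<alpha> + \<theta> + \<mu>) i))\<^sup>2 = 2 - 2 * cos (\<theta> + \<mu>)"
    unfolding corner_def dist_cis by (simp add: cos_diff cos_add sin_add algebra_simps) 
  also have "\<dots> = ((sin \<mu>)\<^sup>2 + (cos \<mu>)\<^sup>2) + ((sin \<theta>)\<^sup>2 + (cos \<theta>)\<^sup>2) - 2 * cos (\<theta> + \<mu>)" by simp
  also have "\<dots> = (sin \<mu> + sin \<theta>)\<^sup>2 + (cos \<mu> - cos \<theta>)\<^sup>2"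
    unfolding cos_add by (simp only: power2_eq_square) (simp add: algebra_simps)
  finally show ?thesis .
qed

lemma dist_corner_prev:
  "(dist (corner \<alpha> (i + 1)) (corner (\<alpha> + \<theta> + \<mu>) i))\<^sup>2 = (sin \<theta> - sin \<mu>)\<^sup>2 + (cos \<mu> - cos \<theta>)\<^sup>2"
proof -
  have "(dist (corner \<alpha> (i + 1)) (corner (\<alpha> + \<theta> + \<mu>) i))\<^sup>2 = 2 - 2 * cos (\<mu> - \<theta>)"
    unfolding corner_def dist_cis by (simp add: algebra_simps)
  also have "\<dots> = ((sin \<mu>)\<^sup>2 + (cos \<mu>)\<^sup>2) + ((sin \<theta>)\<^sup>2 + (cos \<theta>)\<^sup>2) - 2 * cos (\<mu> - \<theta>)" by simp
  also have "\<dots> = (sin \<theta> - sin \<mu>)\<^sup>2 + (cos \<mu> - cos \<theta>)\<^sup>2"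
    unfolding cos_diff by (simp only: power2_eq_square) (simp add: algebra_simps)
  finally show ?thesis .
qed

text \<open>
The polygons are at the heights \<open>0\<close>, \<open>(1/2 - e) H\<close>, \<open>H/2\<close>, \<open>(1/2 + e) H\<close>, \<open>H\<close> and again \<open>0\<close>. The
closing condition says that the total rotation \<open>2 \<phi> + \<theta> + 7 \<mu>\<close> is \<open>\<kappa>\<close> steps of \<open>2 \<mu>\<close>. The number \<open>e\<close> has
to be small because the two low bands only stay clear of the inner band near its waist, at \<open>H/2\<close>.
\<close>

theorem five_band_torus:
  fixes \<phi> \<theta> e H :: real and \<kappa> :: int
  assumes \<phi>: "\<mu> \<le> \<bar>\<phi>\<bar>" and \<theta>: "\<bar>\<phi>\<bar> + 2 * \<mu> < \<theta>" "\<theta> < pi - \<mu>"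
    and closing: "2 * \<phi> + \<theta> = (2 * of_int \<kappa> - 7) * \<mu>"
    and e: "0 < e" "e < 1 / 2" "8 * e\<^sup>2 < cos (\<bar>\<phi>\<bar> + \<mu>) - cos (\<theta> - \<mu>)"
    and H: "H > 0"
  shows "\<exists>f. origami_embedding
    (lattice_gen (of_real (real n * (2 * sin \<mu>)))
      (Complex (2 * sin \<phi> + sin \<theta> - (2 * of_int \<kappa> - 7) * sin \<mu>)
        ((1 - 2 * e) * H + 2 * sqrt ((e * H)\<^sup>2 + (cos \<mu> - cos \<phi>)\<^sup>2) + sqrt (H\<^sup>2 + (cos \<mu> - cos \<theta>)\<^sup>2)))) f"
proof -
  define T where "T = (\<lambda>j. [\<mu>, \<phi>, \<phi>, \<mu>, \<theta>] ! j)"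
  define z where "z = (\<lambda>j. [0, (1 / 2 - e) * H, H / 2, (1 / 2 + e) * H, H, 0] ! j)"
  define \<alpha> where "\<alpha> = (\<lambda>j. \<Sum>l<j. T l + \<mu>)"
  define x where "x = (\<lambda>j. \<Sum>l<j. sin \<mu> + sin (T l))"
  define h where "h = (\<lambda>j. sqrt ((z (Suc j) - z j)\<^sup>2 + (cos \<mu> - cos (T j))\<^sup>2))"
  define y where "y = (\<lambda>j. \<Sum>l<j. h l)"
  define g where "g = (\<lambda>j i. vec3 (corner (\<alpha> j) i) (z j))"
  have T: "T 0 = \<mu>" "T (Suc 0) = \<phi>" "T 2 = \<phi>" "T 3 = \<mu>" "T 4 = \<theta>"
    by (simp_all add: T_def)
  have z: "z 0 = 0" "z (Suc 0) = (1 / 2 - e) * H" "z 2 = H / 2" "z 3 = (1 / 2 + e) * H" "z 4 = H" "z 5 = 0"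
    by (simp_all add: z_def)
  have j5: "j = 0 \<or> j = Suc 0 \<or> j = 2 \<or> j = 3 \<or> j = 4" if "j < 5" for j :: nat
    using that by linarith
  have Suc: "Suc (Suc 0) = 2" "Suc 2 = 3" "Suc 3 = 4" "Suc 4 = 5" by simp_all
  have z_ne: "z (Suc j) \<noteq> z j" if "j < 5" for j
    using j5[OF that] e H by (auto simp: z Suc)
  have z_step: "z j < z (Suc j)" if "j < 4" for j
    using j5[of j] that e H by (auto simp: z Suc)
  have h_pos: "h j > 0" if "j < 5" for j
    unfolding h_def using z_ne[OF that] by (intro real_sqrt_gt_zero add_pos_nonneg) auto
  have \<alpha>_Suc: "\<alpha> (Suc j) = \<alpha> j + T j + \<mu>" for j by (simp add: \<alpha>_def)
  have x_Suc: "x (Suc j) = x j + (sin \<mu> + sin (T j))" for j by (simp add: x_def)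
  have y_Suc: "y (Suc j) = y j + h j" for j by (simp add: y_def)
  have lessThan5: "{..<5::nat} = {0, Suc 0, 2, 3, 4}" by auto
  have \<alpha>5: "\<alpha> 5 = 2 * \<mu> * of_int \<kappa>" and \<alpha>0: "\<alpha> 0 = 0"
    using closing by (simp_all add: \<alpha>_def lessThan5 T algebra_simps)
  interpret strip: flat_strip 5 n "2 * sin \<mu>" x y \<kappa>
  proof
    show "y j < y (Suc j)" if "j < 5" for j using h_pos[OF that] by (simp add: y_Suc)
  qed (use n mu_trig in \<open>auto simp: x_def y_def\<close>)
  have "strip.hperiod = of_real (real n * (2 * sin \<mu>))"
    unfolding strip.hperiod_def ..
  moreover have "strip.vperiod = Complex (2 * sin \<phi> + sin \<theta> - (2 * of_int \<kappa> - 7) * sin \<mu>)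
        ((1 - 2 * e) * H + 2 * sqrt ((e * H)\<^sup>2 + (cos \<mu> - cos \<phi>)\<^sup>2) + sqrt (H\<^sup>2 + (cos \<mu> - cos \<theta>)\<^sup>2))"
  proof -
    have "x 5 - of_int \<kappa> * (2 * sin \<mu>) = 2 * sin \<phi> + sin \<theta> - (2 * of_int \<kappa> - 7) * sin \<mu>"
      by (simp add: x_def lessThan5 T algebra_simps)
    moreover have "y 5 = (1 - 2 * e) * H + 2 * sqrt ((e * H)\<^sup>2 + (cos \<mu> - cos \<phi>)\<^sup>2) + sqrt (H\<^sup>2 + (cos \<mu> - cos \<theta>)\<^sup>2)"
    proof -
      have "z (Suc 0) - z 0 = (1 / 2 - e) * H" "z 2 - z (Suc 0) = e * H" "z 3 - z 2 = e * H"
        "z 4 - z 3 = (1 / 2 - e) * H" "z 5 - z 4 = - H"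
        by (simp_all add: z field_simps)
      moreover have "sqrt (((1 / 2 - e) * H)\<^sup>2) = (1 / 2 - e) * H" using e H by simp
      ultimately show ?thesis
        by (simp add: y_def lessThan5 h_def T Suc)
    qed
    ultimately show ?thesis by (simp add: strip.vperiod_def)
  qed
  moreover have "\<exists>f. origami_embedding strip.periods f"
  proof (rule strip.origami_embedding_of_strip[of g])
    show "strip.vertex_data g"
      unfolding strip.vertex_data_def
    proof (intro conjI allI)
      show "g j (i + int n) = g j i" for j i
        using corner_periodic[of "\<alpha> j" i 1] by (simp add: g_def)
      show "g 5 i = g 0 (i + \<kappa>)" for i
        by (simp add: g_def z \<alpha>5 \<alpha>0 corner_def algebra_simps)
    qed
    show "dist (g j i) (g j (i + 1)) = 2 * sin \<mu>" for j i
    proof -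
      have "dist (g j i) (g j (i + 1)) = \<bar>2 * sin \<mu>\<bar>"
        unfolding g_def dist_vec3 dist_corner_next by (simp only: diff_self power2_eq_square mult_zero_left add_0_right real_sqrt_abs2)
      then show ?thesis using mu_trig by simp
    qed
    have h2: "(h j)\<^sup>2 = (z (Suc j) - z j)\<^sup>2 + (cos \<mu> - cos (T j))\<^sup>2" for j
      by (simp add: h_def)
    show "dist (g j i) (g (Suc j) i) = dist (strip.vertex j i) (strip.vertex (Suc j) i)" for j i
    proof -
      have "dist (strip.vertex j i) (strip.vertex (Suc j) i) = sqrt ((sin \<mu> + sin (T j))\<^sup>2 + (h j)\<^sup>2)"
        by (simp add: strip.vertex_def dist_complex_def cmod_def x_Suc y_Suc power2_commute algebra_simps)
      then show ?thesis
        by (simp only: g_def dist_vec3 \<alpha>_Suc dist_corner_same h2) (simp add: power2_commute algebra_simps)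
    qed
    show "dist (g j (i + 1)) (g (Suc j) i) = dist (strip.vertex j (i + 1)) (strip.vertex (Suc j) i)" for j i
    proof -
      have "dist (strip.vertex j (i + 1)) (strip.vertex (Suc j) i) = sqrt ((sin (T j) - sin \<mu>)\<^sup>2 + (h j)\<^sup>2)"
        by (simp add: strip.vertex_def dist_complex_def cmod_def x_Suc y_Suc power2_commute algebra_simps)
      then show ?thesis
        by (simp only: g_def dist_vec3 \<alpha>_Suc dist_corner_prev h2) (simp add: power2_commute algebra_simps)
    qed
    fix j t r j' t' r'
    assume j: "j < 5" "0 \<le> t" "t < 1" and j': "j' < 5" "0 \<le> t'" "t' < 1"
      and eq: "band_map (g j) (g (Suc j)) t r = band_map (g j') (g (Suc j')) t' r'"
    define lev where "lev = (\<lambda>j t. (1 - t) * z j + t * z (Suc j))"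
    have "band_map (g j) (g (Suc j)) t r = vec3 (slice (\<alpha> j) (T j) t r) (lev j t)" for j t r
      by (simp add: g_def band_map_vec3 \<alpha>_Suc lev_def)
    then have sec: "slice (\<alpha> j) (T j) t r = slice (\<alpha> j') (T j') t' r'" and lev: "lev j t = lev j' t'"
      using eq by (simp_all add: vec3_eq_iff)
    have lev_eq: "lev j t = z j + t * (z (Suc j) - z j)" for j t by (simp add: lev_def algebra_simps)
    have \<theta>3: "3 * \<mu> < \<theta>" using \<phi> \<theta> by simp
    have T_bounds: "\<mu> \<le> \<bar>T j\<bar> \<and> \<bar>T j\<bar> < pi - \<mu>" if "j < 5" for j
      using j5[OF that] \<phi> \<theta> \<theta>3 mu by (auto simp: T)
    have lev_bounds: "z j \<le> lev j t \<and> lev j t < z (Suc j)" if "j < 4" "0 \<le> t" "t < 1" for j t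
    proof -
      have "z (Suc j) - lev j t = (1 - t) * (z (Suc j) - z j)" "lev j t - z j = t * (z (Suc j) - z j)"
        by (simp_all add: lev_def algebra_simps)
      moreover have "0 < (1 - t) * (z (Suc j) - z j)" "0 \<le> t * (z (Suc j) - z j)"
        using that z_step[of j] by auto
      ultimately show ?thesis by simp
    qed
    have z_mono: "z i \<le> z k" if "i \<le> k" "k \<le> 4" for i k
      using that
    proof (induction k)
      case (Suc k)
      then show ?case using z_step[of k] by (cases "i = Suc k") auto
    qed simp
    have same: "j = j' \<and> t = t' \<and> (\<exists>m. r - r' = of_int m * real n)"
      if "j = j'"
    proof -
      have "t = t'" using that lev j z_ne[of j] by (simp add: lev_eq)
      then show ?thesis using that j sec slice_inj[of "T j" t "\<alpha> j" r r'] T_bounds[of j] by simp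
    qed
    \<comment> \<open>The inner band cannot meet an outer one at a common level. The level bounds the inner parameter \<open>t'\<close>,
      which decides between the argument with the faces of a prism and the comparison of radii.\<close>
    have nested: False
      if j: "j < 4" and t: "0 \<le> t" "t < 1" and t': "0 \<le> t'" "t' < 1" and lev: "lev j t = lev 4 t'"
        and sec: "slice (\<alpha> j) (T j) t r = slice (\<alpha> 4) (T 4) t' r'" for j t r t' r'
    proof -
      define p where "p = slice (\<alpha> 4) \<theta> t' r'"
      have p: "p = slice (\<alpha> j) (T j) t r" by (simp add: p_def sec T)
      have lev4: "lev 4 t' = (1 - t') * H" by (simp add: lev_eq z algebra_simps)
      have lb: "z j \<le> (1 - t') * H" "(1 - t') * H < z (Suc j)"
        using lev_bounds[OF j t] lev lev4 by auto
      have "(1 - t') * H < 1 * H" using lb(2) z_mono[of "Suc j" 4] j by (simp add: z)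
      then have t'0: "0 < t'" using H by (simp only: mult_less_cancel_right_pos)
      have \<alpha>_last: "\<alpha> 4 + \<theta> + \<mu> = 2 * \<mu> * of_int \<kappa>" using \<alpha>_Suc[of 4] \<alpha>5 by (simp add: T Suc)
      consider "j = 0" | "j = 1 \<or> j = 2" | "j = 3" using j by linarith
      then show False
      proof cases
        case 1
        have "(1 - t') * H < (1 / 2) * H" using lb(2) 1 e H z_mono[of 1 2] by (simp add: z)
        then have "1 / 2 \<le> t'" using H by (simp only: mult_less_cancel_right_pos)
        then have in': "Re (p * side_frame (2 * \<mu> * of_int \<kappa>) k) < cos \<mu>" for k
          using slice_inside_last_prism[OF \<theta>3 _ _ t'(2), of "\<alpha> 4" r' k] \<theta> unfolding p_def \<alpha>_last by simp
        obtain k where "Re (p * side_frame 0 k) = cos \<mu>"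
          using prism_slice[OF t, of "\<alpha> 0" r] unfolding p 1 T \<alpha>0 by blast
        moreover have "side_frame 0 k = side_frame (2 * \<mu> * of_int \<kappa>) (k - \<kappa>)" by (simp add: side_frame_def algebra_simps)
        ultimately show False using in'[of "k - \<kappa>"] by simp
      next
        case 3
        have "(1 / 2) * H \<le> (1 - t') * H" using lb(1) 3 e H z_mono[of 2 3] by (simp add: z)
        then have "t' \<le> 1 / 2" using H by (simp only: mult_le_cancel_right_pos)
        then have in': "Re (p * side_frame (\<alpha> 4) k) < cos \<mu>" for k
          using slice_inside_first_prism[OF \<theta>3 _ t'0, of "\<alpha> 4" r' k] \<theta> unfolding p_def by simp
        obtain k where "Re (p * side_frame (\<alpha> 3) k) = cos \<mu>"
          using prism_slice[OF t, of "\<alpha> 3" r] unfolding p 3 T by blast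
        moreover have "side_frame (\<alpha> 3) k = side_frame (\<alpha> 4) (k - 1)"
          using \<alpha>_Suc[of 3] by (simp add: side_frame_def T Suc algebra_simps)
        ultimately show False using in'[of "k - 1"] by simp
      next
        case 2
        have Tj: "T j = \<phi>" using 2 T by auto
        have "(1 / 2 - e) * H \<le> (1 - t') * H" "(1 - t') * H \<le> (1 / 2 + e) * H"
          using lb 2 z_mono[of 1 2] z_mono[of 2 3] by (auto simp: z Suc)
        then have t'e: "\<bar>t' - 1 / 2\<bar> \<le> e"
          using H by (simp only: mult_le_cancel_right_pos)
        have sq: "(t' - 1 / 2)\<^sup>2 \<le> e\<^sup>2" using t'e by (simp add: abs_le_square_iff[symmetric])
        let ?w = "\<bar>\<phi>\<bar> + \<mu>" and ?C = "cos (\<theta> - \<mu>)"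
        have C: "- 1 \<le> ?C" "?C \<le> 1" by auto
        have cw: "cos (?w / 2) \<ge> 0" using \<phi> \<theta> mu by (intro cos_ge_zero) auto
        have "cos (?w / 2) \<le> cmod p"
          unfolding p Tj using \<phi> \<theta> mu t by (intro slice_norm_ge) auto
        then have "(cos (?w / 2))\<^sup>2 \<le> (cmod p)\<^sup>2" using cw by (intro power_mono)
        also have "\<dots> \<le> 1 - 2 * t' * (1 - t') * (1 - ?C)"
          unfolding p_def using \<theta>3 \<theta> mu t'0 t' by (intro slice_norm_le) auto
        also have "\<dots> = (1 + ?C) / 2 + 2 * (t' - 1 / 2)\<^sup>2 * (1 - ?C)"
          by (simp add: power2_eq_square field_simps)
        also have "\<dots> \<le> (1 + ?C) / 2 + 2 * e\<^sup>2 * 2"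
          using sq C by (intro add_left_mono mult_mono) auto
        finally have "(cos (?w / 2))\<^sup>2 \<le> (1 + ?C) / 2 + 2 * e\<^sup>2 * 2" .
        moreover have "cos ?w = 2 * (cos (?w / 2))\<^sup>2 - 1"
          unfolding cos_double_cos[symmetric] by (simp only: times_divide_eq_right nonzero_mult_div_cancel_left zero_neq_numeral not_False_eq_True)
        ultimately show False using e(3) by argo
      qed
    qed
    show "j = j' \<and> t = t' \<and> (\<exists>m. r - r' = of_int m * real n)"
    proof -
      consider "j = j'" | "j < 4" "j' = 4" | "j = 4" "j' < 4" | "j < j'" "j' < 4" | "j' < j" "j < 4"
        using j(1) j'(1) by linarith
      then show ?thesis
      proof cases
        case 1 then show ?thesis by (rule same)
      next
        case 2 then show ?thesis using nested[of j t t' r r'] j j' lev sec by simp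
      next
        case 3 then show ?thesis using nested[of j' t' t r' r] j j' lev sec by simp
      next
        case 4 then show ?thesis
          using lev_bounds[of j t] lev_bounds[of j' t'] z_mono[of "Suc j" j'] j j' lev by simp
      next
        case 5 then show ?thesis
          using lev_bounds[of j t] lev_bounds[of j' t'] z_mono[of "Suc j'" j] j j' lev by simp
      qed
    qed
  qed
  ultimately show ?thesis by simp
qed

end

section \<open>Choice of angles and heights\<close>

text \<open>
The left hand side is the flat height of the five bands as a function of the height \<open>H\<close> in space. It
starts at \<open>2 a + b\<close> and is unbounded.
\<close>

lemma height_solution:
  fixes a b e Y :: real
  assumes "0 \<le> a" "0 \<le> b" "0 < e" "e < 1 / 2" "2 * a + b < Y"
  shows "\<exists>H>0. (1 - 2 * e) * H + 2 * sqrt ((e * H)\<^sup>2 + a\<^sup>2) + sqrt (H\<^sup>2 + b\<^sup>2) = Y"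
proof -
  let ?f = "\<lambda>H. (1 - 2 * e) * H + 2 * sqrt ((e * H)\<^sup>2 + a\<^sup>2) + sqrt (H\<^sup>2 + b\<^sup>2)"
  let ?M = "Y / (1 - 2 * e)"
  have M: "0 \<le> ?M" "(1 - 2 * e) * ?M = Y" using assms by auto
  have f0: "?f 0 = 2 * a + b" using assms by simp
  have "Y \<le> ?f ?M" unfolding M(2) by simp
  moreover have "continuous_on {0..?M} ?f" by (intro continuous_intros)
  ultimately obtain H where H: "0 \<le> H" "?f H = Y"
    using IVT'[of ?f 0 Y ?M] M f0 assms by auto
  then have "H \<noteq> 0" using f0 assms by auto
  then show ?thesis using H by (intro exI[of _ H]) auto
qed

context regular_polygon begin

text \<open>
Since \<open>\<bar>\<phi>\<bar> + \<mu> < \<theta> - \<mu>\<close>, the waist of the inner band is strictly narrower than the hole of the low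
bands, and half of the available margin is spent on their heights.
\<close>

lemma torus_of_angles:
  assumes \<phi>: "\<mu> \<le> \<bar>\<phi>\<bar>" and \<theta>: "\<bar>\<phi>\<bar> + 2 * \<mu> < \<theta>" "\<theta> < pi - \<mu>"
    and closing: "2 * \<phi> + \<theta> = (2 * of_int \<kappa> - 7) * \<mu>"
    and Y: "2 * (cos \<mu> - cos \<phi>) + (cos \<mu> - cos \<theta>) < Y"
  shows "\<exists>f. origami_embedding (lattice_gen (of_real (real n * (2 * sin \<mu>)))
      (Complex (2 * sin \<phi> + sin \<theta> - (2 * of_int \<kappa> - 7) * sin \<mu>) Y)) f"
proof -
  define D where "D = cos (\<bar>\<phi>\<bar> + \<mu>) - cos (\<theta> - \<mu>)"
  have "cos (\<theta> - \<mu>) < cos (\<bar>\<phi>\<bar> + \<mu>)" using \<phi> \<theta> mu by (intro cos_monotone_0_pi) auto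
  then have D: "D > 0" by (simp add: D_def)
  have D2: "D \<le> 2" unfolding D_def using cos_le_one[of "\<bar>\<phi>\<bar> + \<mu>"] cos_ge_minus_one[of "\<theta> - \<mu>"] by linarith
  define e where "e = sqrt (D / 16)"
  have e: "e > 0" "e\<^sup>2 = D / 16" using D by (simp_all add: e_def)
  have "e < 1 / 2"
  proof (rule power2_less_imp_less)
    show "e\<^sup>2 < (1 / 2)\<^sup>2" unfolding e(2) using D2 by (simp add: power2_eq_square)
  qed simp
  have "cos \<bar>\<phi>\<bar> \<le> cos \<mu>" using \<phi> \<theta> mu by (intro cos_monotone_0_pi_le) auto
  moreover have "cos \<theta> \<le> cos \<mu>" using \<phi> \<theta> mu by (intro cos_monotone_0_pi_le) auto
  ultimately obtain H where H: "H > 0"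
    "(1 - 2 * e) * H + 2 * sqrt ((e * H)\<^sup>2 + (cos \<mu> - cos \<phi>)\<^sup>2) + sqrt (H\<^sup>2 + (cos \<mu> - cos \<theta>)\<^sup>2) = Y"
    using height_solution[of "cos \<mu> - cos \<phi>" "cos \<mu> - cos \<theta>" e Y] e \<open>e < 1 / 2\<close> Y by auto
  have "8 * e\<^sup>2 < cos (\<bar>\<phi>\<bar> + \<mu>) - cos (\<theta> - \<mu>)"
    unfolding e(2) D_def[symmetric] using D by simp
  from five_band_torus[OF \<phi> \<theta> closing e(1) \<open>e < 1 / 2\<close> this H(1)]
  show ?thesis unfolding H(2) .
qed

end

text \<open>
Two constraints lead to 36. The angles below keep a distance of \<open>\<pi> / 12\<close> from the limits of
embeddedness, which must exceed \<open>2 \<mu>\<close>, so \<open>n > 24\<close>; and all of \<open>-\<pi>/4\<close>, \<open>13\<pi>/12\<close>,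
\<open>19\<pi>/12\<close> and \<open>7\<pi>/4\<close> have to be odd multiples of \<open>\<pi> / n\<close>, so \<open>n\<close> is an odd multiple of 12.
\<close>

interpretation gon36: regular_polygon 36 by unfold_locales simp

lemma mu36: "gon36.\<mu> = pi / 36"
  by (simp add: gon36.\<mu>_def)

lemma sin_15: "sin (pi / 12) = sqrt 2 * (sqrt 3 - 1) / 4"
proof -
  have "sin (pi / 12) = sin (pi / 3 - pi / 4)" by simp
  then show ?thesis unfolding sin_diff sin_60 cos_60 sin_45 cos_45 by (simp add: algebra_simps)
qed

lemma sin_75: "sin (5 * pi / 12) = sqrt 2 * (sqrt 3 + 1) / 4"
proof -
  have "sin (5 * pi / 12) = sin (pi / 6 + pi / 4)" by simp
  then show ?thesis unfolding sin_add sin_30 cos_30 sin_45 cos_45 by (simp add: algebra_simps)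
qed

lemma sqrt_bounds: "(1414 / 1000) < sqrt 2" "sqrt 2 < (1415 / 1000)" "(1732 / 1000) < sqrt 3" "sqrt 3 < (1733 / 1000)"
  by (rule real_less_rsqrt real_less_lsqrt; simp add: power2_eq_square)+

lemma sin_15_75_bounds:
  "(258 / 1000) < sin (pi / 12)" "sin (pi / 12) < (26 / 100)" "(965 / 1000) < sin (5 * pi / 12)" "sin (5 * pi / 12) < (967 / 1000)"
proof -
  have "(1414 / 1000) * (732 / 1000) < sqrt 2 * (sqrt 3 - 1)"
    "sqrt 2 * (sqrt 3 - 1) < (1415 / 1000) * (733 / 1000)"
    "(1414 / 1000) * (2732 / 1000) < sqrt 2 * (sqrt 3 + 1)"
    "sqrt 2 * (sqrt 3 + 1) < (1415 / 1000) * (2733 / 1000)"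
    by (rule mult_strict_mono; use sqrt_bounds in simp)+
  then show "(258 / 1000) < sin (pi / 12)" "sin (pi / 12) < (26 / 100)" "(965 / 1000) < sin (5 * pi / 12)" "sin (5 * pi / 12) < (967 / 1000)"
    unfolding sin_15 sin_75 by auto
qed

text \<open>
From the formula for the sine of a tripled angle, as \<open>3 \<mu> = \<pi> / 12\<close>.
\<close>

lemma sin_mu36_bounds: "(86 / 1000) \<le> sin gon36.\<mu>" "sin gon36.\<mu> \<le> (882 / 10000)"
proof -
  let ?S = "sin gon36.\<mu>"
  have S: "0 < ?S" by (rule gon36.mu_trig)
  have C: "(cos gon36.\<mu>)\<^sup>2 = 1 - ?S\<^sup>2" by (rule cos_squared_eq)
  have "sin (pi / 12) = sin (2 * gon36.\<mu> + gon36.\<mu>)" by (simp add: mu36)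
  also have "\<dots> = 2 * ?S * (cos gon36.\<mu>)\<^sup>2 + (1 - 2 * ?S\<^sup>2) * ?S"
    by (simp only: sin_add sin_double cos_double_sin) (simp add: power2_eq_square)
  also have "\<dots> = 3 * ?S - 4 * ?S * ?S\<^sup>2"
    unfolding C by (simp add: algebra_simps)
  finally have B: "sin (pi / 12) = 3 * ?S - 4 * ?S * ?S\<^sup>2" .
  have "0 \<le> 4 * ?S * ?S\<^sup>2" using S by simp
  then show "(86 / 1000) \<le> ?S" using B sin_15_75_bounds(1) by linarith
  have "?S \<le> 1 / 9" using sin_x_le_x[of gon36.\<mu>] pi_less_4 by (simp add: mu36)
  then have "?S\<^sup>2 \<le> (1 / 9)\<^sup>2" using S by (intro power_mono) auto
  then have "4 * ?S * ?S\<^sup>2 \<le> 4 * ?S * (1 / 81)" using S by (intro mult_left_mono) (auto simp: power2_eq_square)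
  then show "?S \<le> (882 / 10000)" using B sin_15_75_bounds(2) by linarith
qed

text \<open>
The negative of the horizontal component of the second lattice vector, when the inner angle is
determined from \<open>\<phi>\<close> by the closing condition with the odd number \<open>q\<close>.
\<close>

definition twist :: "int \<Rightarrow> real \<Rightarrow> real" where
  "twist q \<phi> = of_int q * sin gon36.\<mu> - 2 * sin \<phi> - sin (of_int q * gon36.\<mu> - 2 * \<phi>)"

definition admissible :: "real \<Rightarrow> real \<Rightarrow> bool" where
  "admissible w \<phi> \<longleftrightarrow> (\<exists>\<theta> \<kappa>. gon36.\<mu> \<le> \<bar>\<phi>\<bar> \<and> \<bar>\<phi>\<bar> \<le> 7 * pi / 12 \<and> \<bar>\<phi>\<bar> + 2 * gon36.\<mu> < \<theta> \<and> \<theta> < pi - gon36.\<mu> \<and>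
     2 * \<phi> + \<theta> = (2 * of_int \<kappa> - 7) * gon36.\<mu> \<and>
     2 * sin \<phi> + sin \<theta> - (2 * of_int \<kappa> - 7) * sin gon36.\<mu> = - w)"

lemma twist_solution:
  assumes q: "q = 2 * \<kappa> - 7" and ord: "lo \<le> hi" and w: "twist q hi \<le> w" "w \<le> twist q lo"
    and ok: "\<And>\<phi>. lo \<le> \<phi> \<Longrightarrow> \<phi> \<le> hi \<Longrightarrow> gon36.\<mu> \<le> \<bar>\<phi>\<bar> \<and> \<bar>\<phi>\<bar> \<le> 7 * pi / 12 \<and>
      \<bar>\<phi>\<bar> + 2 * gon36.\<mu> < of_int q * gon36.\<mu> - 2 * \<phi> \<and> of_int q * gon36.\<mu> - 2 * \<phi> < pi - gon36.\<mu>"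
  shows "\<exists>\<phi>. admissible w \<phi>"
proof -
  have "continuous_on {lo..hi} (twist q)" unfolding twist_def by (intro continuous_intros)
  then obtain \<phi> where \<phi>: "lo \<le> \<phi>" "\<phi> \<le> hi" "twist q \<phi> = w"
    using IVT2'[of "twist q" hi w lo] ord w by auto
  have "2 * sin \<phi> + sin (of_int q * gon36.\<mu> - 2 * \<phi>) - (2 * of_int \<kappa> - 7) * sin gon36.\<mu> = - w"
    using \<phi>(3) by (simp add: twist_def q)
  then have "admissible w \<phi>"
    unfolding admissible_def using ok[OF \<phi>(1,2)] 
    by (intro exI[of _ "of_int q * gon36.\<mu> - 2 * \<phi>"] exI[of _ \<kappa>]) (simp add: q)
  then show ?thesis ..
qed

text \<open>
Over \<open>[-7\<pi>/12, -\<pi>/3]\<close>, \<open>[\<pi>/12, \<pi>/3]\<close>, \<open>[\<pi>/3, \<pi>/2]\<close> and \<open>[5\<pi>/12, \<pi>/2]\<close>, with \<open>q\<close> equal to \<open>-9\<close>,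
\<open>39\<close>, \<open>57\<close> and \<open>63\<close>, the twist covers four overlapping intervals. With \<open>sin \<mu>\<close> about \<open>0.0872\<close>
they are approximately \<open>[-0.02, 0.89]\<close>, \<open>[0.70, 2.62]\<close>, \<open>[2.00, 2.98]\<close> and \<open>[2.78, 3.30]\<close>, while half the
circumference is about \<open>3.14\<close>. The end points are chosen such that all sines are known exactly.
\<close>

lemma twists_exhaust:
  assumes w: "0 \<le> w" "w \<le> 36 * sin gon36.\<mu>"
  shows "\<exists>\<phi>. admissible w \<phi>"
proof -
  let ?S = "sin gon36.\<mu>" and ?A = "sin (5 * pi / 12)" and ?B = "sin (pi / 12)"
  have A': "sin (7 * pi / 12) = ?A"
  proof -
    have "sin (7 * pi / 12) = sin (pi - 5 * pi / 12)" by simp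
    then show ?thesis by (simp only: sin_pi_minus)
  qed
  have B': "sin (11 * pi / 12) = ?B"
  proof -
    have "sin (11 * pi / 12) = sin (pi - pi / 12)" by simp
    then show ?thesis by (simp only: sin_pi_minus)
  qed
  have C: "sin (3 * pi / 4) = sqrt 2 / 2"
  proof -
    have "sin (3 * pi / 4) = sin (pi - pi / 4)" by simp
    then show ?thesis by (simp only: sin_pi_minus sin_45)
  qed
  have tw: "twist q \<phi> = of_int q * ?S - 2 * sin \<phi> - sin x" if "of_int q * pi / 36 - 2 * \<phi> = x" for q \<phi> x
    using that by (simp add: twist_def mu36)
  have v: "twist (-9) (- (7 * pi / 12)) = - 9 * ?S + 2 * ?A - ?B"
    "twist (-9) (- (pi / 3)) = - 9 * ?S + sqrt 3 - ?A"
    "twist 39 (pi / 12) = 39 * ?S - 3 * ?B"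
    "twist 39 (pi / 3) = 39 * ?S - sqrt 3 - ?A"
    "twist 57 (pi / 3) = 57 * ?S - sqrt 3 - ?B"
    "twist 57 (pi / 2) = 57 * ?S - 2 - ?A"
    "twist 63 (5 * pi / 12) = 63 * ?S - 2 * ?A - ?B"
    "twist 63 (pi / 2) = 63 * ?S - 2 - sqrt 2 / 2"
    using tw[of "-9" "- (7 * pi / 12)" "11 * pi / 12"] tw[of "-9" "- (pi / 3)" "5 * pi / 12"]
      tw[of 39 "pi / 12" "11 * pi / 12"] tw[of 39 "pi / 3" "5 * pi / 12"]
      tw[of 57 "pi / 3" "11 * pi / 12"] tw[of 57 "pi / 2" "7 * pi / 12"]
      tw[of 63 "5 * pi / 12" "11 * pi / 12"] tw[of 63 "pi / 2" "3 * pi / 4"]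
    by (simp_all add: A' B' C sin_60)
  note b = sqrt_bounds sin_15_75_bounds sin_mu36_bounds
  have pi: "pi > 0" by simp
  consider "w \<le> twist (-9) (- (7 * pi / 12))"
    | "twist (-9) (- (7 * pi / 12)) \<le> w" "w \<le> twist 39 (pi / 12)"
    | "twist 39 (pi / 12) \<le> w" "w \<le> twist 57 (pi / 3)"
    | "twist 57 (pi / 3) \<le> w" by linarith
  then show ?thesis
  proof cases
    case 1
    show ?thesis
    proof (rule twist_solution[where q = "-9" and \<kappa> = "-1" and lo = "- (7 * pi / 12)" and hi = "- (pi / 3)"])
      show "twist (-9) (- (pi / 3)) \<le> w" unfolding v using w b by linarith
    qed (use 1 pi in \<open>auto simp: mu36 abs_if simp del: pi_gt_zero\<close>)
  next
    case 2
    show ?thesis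
    proof (rule twist_solution[where q = 39 and \<kappa> = 23 and lo = "pi / 12" and hi = "pi / 3"])
      show "twist 39 (pi / 3) \<le> w" using 2(1) unfolding v using b by linarith
    qed (use 2 pi in \<open>auto simp: mu36 abs_if simp del: pi_gt_zero\<close>)
  next
    case 3
    show ?thesis
    proof (rule twist_solution[where q = 57 and \<kappa> = 32 and lo = "pi / 3" and hi = "pi / 2"])
      show "twist 57 (pi / 2) \<le> w" using 3(1) unfolding v using b by linarith
    qed (use 3 pi in \<open>auto simp: mu36 abs_if simp del: pi_gt_zero\<close>)
  next
    case 4
    show ?thesis
    proof (rule twist_solution[where q = 63 and \<kappa> = 35 and lo = "5 * pi / 12" and hi = "pi / 2"])
      show "twist 63 (pi / 2) \<le> w" using 4 unfolding v using b by linarith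
      show "w \<le> twist 63 (5 * pi / 12)" using w(2) unfolding v using b by linarith
    qed (use pi in \<open>auto simp: mu36 abs_if simp del: pi_gt_zero\<close>)
  qed
qed

text \<open>
As \<open>\<bar>\<phi>\<bar> \<le> 7\<pi>/12\<close>, the flattened height is at most about \<open>4.52\<close>, and \<open>c * sqrt 3 / 2\<close> is at least
\<open>5.1\<close>.
\<close>

lemma origami_reduced:
  fixes c w Y :: real
  defines "c \<equiv> 72 * sin gon36.\<mu>"
  assumes w: "0 \<le> w" "w \<le> c / 2" and Y: "sqrt 3 / 2 * c \<le> Y"
  shows "\<exists>f. origami_embedding (lattice_gen (of_real c) (Complex (- w) Y)) f"
proof -
  obtain \<phi> \<theta> \<kappa> where *: "gon36.\<mu> \<le> \<bar>\<phi>\<bar>" "\<bar>\<phi>\<bar> + 2 * gon36.\<mu> < \<theta>" "\<theta> < pi - gon36.\<mu>"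
    "2 * \<phi> + \<theta> = (2 * of_int \<kappa> - 7) * gon36.\<mu>"
    and le: "\<bar>\<phi>\<bar> \<le> 7 * pi / 12"
    and tw: "2 * sin \<phi> + sin \<theta> - (2 * of_int \<kappa> - 7) * sin gon36.\<mu> = - w"
    using twists_exhaust[of w] w unfolding admissible_def c_def by auto
  have "cos (7 * pi / 12) = - sin (pi / 12)"
  proof -
    have "cos (7 * pi / 12) = cos (pi / 12 + pi / 2)" by simp
    then show ?thesis by (simp only: cos_add cos_pi_half sin_pi_half)
  qed
  moreover have "cos (7 * pi / 12) \<le> cos \<bar>\<phi>\<bar>" using le by (intro cos_monotone_0_pi_le) auto
  ultimately have "cos \<phi> > - (26 / 100)" using sin_15_75_bounds by simp
  moreover have "(17 / 10) / 2 * 6 \<le> sqrt 3 / 2 * c"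
    using sqrt_bounds sin_mu36_bounds by (intro mult_mono) (auto simp: c_def)
  then have "51 / 10 \<le> Y" using Y by simp
  ultimately have "2 * (cos gon36.\<mu> - cos \<phi>) + (cos gon36.\<mu> - cos \<theta>) < Y"
    using gon36.mu_trig(3) cos_ge_minus_one[of \<theta>] by argo
  from gon36.torus_of_angles[OF *  this]
  show ?thesis unfolding tw by (simp add: c_def)
qed

section \<open>Similar lattices and reduced bases\<close>

lemma image_lattice_gen:
  assumes "linear h"
  shows "h ` lattice_gen w1 w2 = lattice_gen (h w1) (h w2)"
proof -
  have "h (of_int m * w1 + of_int k * w2) = of_int m * h w1 + of_int k * h w2" for m k
    using linear_add[OF assms] linear_scale[OF assms, of "of_int _"]
    by (simp add: scaleR_conv_of_real)
  then show ?thesis unfolding lattice_gen_def by (auto simp: image_iff) metis+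
qed

lemma has_modulus_of_linear_similarity:
  assumes h: "linear h" "\<And>z. norm (h z) = k * norm z" and k: "k > 0"
    and \<Lambda>: "is_lattice \<Lambda>" "h ` \<Lambda> = lattice_gen 1 \<tau>" and \<tau>: "Im \<tau> > 0"
  shows "has_modulus \<Lambda> \<tau>"
proof -
  have dist: "dist (h x) (h y) = k * dist x y" for x y
    using h(2)[of "x - y"] by (simp add: dist_norm linear_diff[OF h(1)])
  have inj: "inj h" using dist k by (metis dist_eq_0_iff injI mult_eq_0_iff less_irrefl)
  then have surj: "surj h" by (rule linear_inj_imp_surj[OF h(1)])
  have proj: "h ` torus_proj \<Lambda> z = torus_proj (lattice_gen 1 \<tau>) (h z)" for z
    by (simp add: torus_proj_def \<Lambda>(2)[symmetric] image_image linear_add[OF h(1)])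
  have "setdist (h ` X) (h ` Y) = k * setdist X Y" if ne: "X \<noteq> {}" "Y \<noteq> {}" for X Y
  proof (rule antisym)
    have "setdist (h ` X) (h ` Y) / k \<le> setdist X Y"
    proof (rule le_setdistI[OF ne])
      fix x y assume "x \<in> X" "y \<in> Y"
      then have "setdist (h ` X) (h ` Y) \<le> dist (h x) (h y)" by (intro setdist_le_dist) auto
      then show "setdist (h ` X) (h ` Y) / k \<le> dist x y" using k by (simp add: dist field_simps)
    qed
    then show "setdist (h ` X) (h ` Y) \<le> k * setdist X Y" using k by (simp add: field_simps)
    show "k * setdist X Y \<le> setdist (h ` X) (h ` Y)"
    proof (rule le_setdistI)
      fix a b assume "a \<in> h ` X" "b \<in> h ` Y"
      then obtain x y where "x \<in> X" "y \<in> Y" "a = h x" "b = h y" by auto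
      then show "k * setdist X Y \<le> dist a b" using k by (simp add: dist setdist_le_dist)
    qed (use ne in auto)
  qed
  moreover have "X \<noteq> {}" if "X \<in> flat_torus \<Lambda>" for X
    using that torus_proj_self[OF \<Lambda>(1)] by (auto simp: flat_torus_def)
  moreover have "bij_betw ((`) h) (flat_torus \<Lambda>) (flat_torus (lattice_gen 1 \<tau>))"
  proof (rule bij_betwI')
    show "h ` X = h ` Y \<longleftrightarrow> X = Y" for X Y using inj by (simp add: inj_image_eq_iff)
    show "h ` X \<in> flat_torus (lattice_gen 1 \<tau>)" if "X \<in> flat_torus \<Lambda>" for X
      using that by (auto simp: flat_torus_def proj)
    show "\<exists>X\<in>flat_torus \<Lambda>. Y = h ` X" if Y: "Y \<in> flat_torus (lattice_gen 1 \<tau>)" for Y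
    proof -
      obtain z where z: "Y = torus_proj (lattice_gen 1 \<tau>) z" using Y by (auto simp: flat_torus_def)
      obtain x where "z = h x" using surj by auto
      then show ?thesis using z by (auto simp: flat_torus_def proj intro!: bexI[of _ "torus_proj \<Lambda> x"])
    qed
  qed
  ultimately show ?thesis
    unfolding has_modulus_def using \<tau> k by (intro conjI exI[of _ "(`) h"] exI[of _ k]) auto
qed

lemma lattice_gen_swap: "lattice_gen u v = lattice_gen v u"
proof -
  have sub: "lattice_gen u v \<subseteq> lattice_gen v u" for u v
  proof
    fix z assume "z \<in> lattice_gen u v"
    then obtain a b :: int where "z = of_int b * v + of_int a * u"
      by (auto simp: lattice_gen_def add.commute)
    then show "z \<in> lattice_gen v u" unfolding lattice_gen_def by blast
  qed
  from sub[of u v] sub[of v u] show ?thesis by auto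
qed

lemma lattice_gen_shear: "lattice_gen u (v - of_int m * u) = lattice_gen u v"
proof -
  have sub: "lattice_gen u (v - of_int m * u) \<subseteq> lattice_gen u v" for m :: int and v
  proof
    fix z assume "z \<in> lattice_gen u (v - of_int m * u)"
    then obtain a b :: int where "z = of_int a * u + of_int b * (v - of_int m * u)"
      by (auto simp: lattice_gen_def)
    then have "z = of_int (a - b * m) * u + of_int b * v" by (simp add: algebra_simps)
    then show "z \<in> lattice_gen u v" unfolding lattice_gen_def by blast
  qed
  from sub[of v m] sub[of "v - of_int m * u" "- m"] show ?thesis by auto
qed

lemma lattice_gen_minus: "lattice_gen u (- v) = lattice_gen u v"
proof -
  have sub: "lattice_gen u (- v) \<subseteq> lattice_gen u v" for v
  proof
    fix z assume "z \<in> lattice_gen u (- v)"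
    then obtain a b :: int where "z = of_int a * u + of_int b * (- v)" by (auto simp: lattice_gen_def)
    then have "z = of_int a * u + of_int (- b) * v" by simp
    then show "z \<in> lattice_gen u v" unfolding lattice_gen_def by blast
  qed
  from sub[of v] sub[of "- v"] show ?thesis by auto
qed

lemma finite_short_vectors:
  assumes "Im \<tau> > 0"
  shows "finite {z \<in> lattice_gen 1 \<tau>. cmod z \<le> 1}"
proof -
  define N where "N = \<lceil>1 / Im \<tau>\<rceil>"
  define M where "M = \<lceil>1 + of_int N * cmod \<tau>\<rceil>"
  have "{z \<in> lattice_gen 1 \<tau>. cmod z \<le> 1} \<subseteq> (\<lambda>(a, b). of_int a + of_int b * \<tau>) ` ({- M..M} \<times> {- N..N})"
  proof
    fix z assume "z \<in> {z \<in> lattice_gen 1 \<tau>. cmod z \<le> 1}"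
    then obtain a b :: int where z: "z = of_int a + of_int b * \<tau>" and le: "cmod z \<le> 1"
      by (auto simp: lattice_gen_def)
    have "\<bar>of_int b\<bar> * Im \<tau> = \<bar>Im z\<bar>" using assms by (simp add: z abs_mult)
    also have "\<dots> \<le> 1" using abs_Im_le_cmod[of z] le by simp
    finally have "\<bar>of_int b\<bar> \<le> 1 / Im \<tau>" using assms by (simp add: field_simps)
    then have b: "\<bar>b\<bar> \<le> N" unfolding N_def by linarith
    have "\<bar>of_int a\<bar> = cmod (z - of_int b * \<tau>)" by (simp add: z)
    also have "\<dots> \<le> cmod z + \<bar>of_int b\<bar> * cmod \<tau>"
      using norm_triangle_ineq4[of z "of_int b * \<tau>"] by (simp add: norm_mult)
    also have "\<dots> \<le> 1 + of_int N * cmod \<tau>"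
      using le b by (intro add_mono mult_right_mono) (auto simp flip: of_int_abs)
    finally have "\<bar>a\<bar> \<le> M" unfolding M_def by linarith
    then show "z \<in> (\<lambda>(a, b). of_int a + of_int b * \<tau>) ` ({- M..M} \<times> {- N..N})"
      using b by (intro image_eqI[of _ _ "(a, b)"]) (auto simp: z abs_le_iff)
  qed
  then show ?thesis by (rule finite_subset) auto
qed

text \<open>
Among all bases choose one whose first vector \<open>u\<close> is as short as possible, which exists because there
are finitely many short lattice vectors, and subtract a multiple of \<open>u\<close> from the second vector. The result
is not shorter than \<open>u\<close>, since exchanging the two vectors gives another basis.
\<close>

lemma reduced_basis:
  assumes \<tau>: "Im \<tau> > 0"
  obtains u v where "lattice_gen u v = lattice_gen 1 \<tau>" "u \<noteq> 0" "\<bar>Re (v / u)\<bar> \<le> 1 / 2" "Im (v / u) \<ge> sqrt 3 / 2"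
proof -
  let ?L = "lattice_gen 1 \<tau>"
  define U where "U = {u. cmod u \<le> 1 \<and> (\<exists>v. lattice_gen u v = ?L)}"
  have mem: "u \<in> lattice_gen u v" for u v :: complex
    unfolding lattice_gen_def mem_Collect_eq by (rule exI[of _ 1], rule exI[of _ 0]) simp
  have "U \<subseteq> {z \<in> ?L. cmod z \<le> 1}" using mem by (fastforce simp: U_def)
  then have "finite U" using finite_short_vectors[OF \<tau>] finite_subset by blast
  moreover have "1 \<in> U" by (auto simp: U_def)
  ultimately obtain u where u: "u \<in> U" "\<And>z. z \<in> U \<Longrightarrow> cmod u \<le> cmod z"
    using arg_min_if_finite[of U cmod] by (metis empty_iff not_le)
  then obtain v where v: "lattice_gen u v = ?L" by (auto simp: U_def)
  have "u \<noteq> 0"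
  proof
    assume "u = 0"
    moreover have "1 \<in> ?L" "\<tau> \<in> ?L" using mem lattice_gen_swap by metis+
    ultimately obtain a b :: int where ab: "1 = of_int a * v" "\<tau> = of_int b * v"
      unfolding v[symmetric] by (auto simp: lattice_gen_def)
    then have "of_int a * \<tau> = of_int b * (of_int a * v)" by simp
    then have "of_int a * \<tau> = of_int b" unfolding ab(1)[symmetric] by simp
    from arg_cong[OF this, of Im] have "of_int a * Im \<tau> = 0" by simp
    then show False using \<tau> ab(1) by auto
  qed
  define w where "w = v - of_int (round (Re (v / u))) * u"
  have w: "lattice_gen u w = ?L" unfolding w_def lattice_gen_shear by (rule v)
  have "w / u = v / u - of_int (round (Re (v / u)))" using \<open>u \<noteq> 0\<close> by (simp add: w_def diff_divide_distrib)
  then have Re: "\<bar>Re (w / u)\<bar> \<le> 1 / 2"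
    using of_int_round_abs_le[of "Re (v / u)"] by (simp add: abs_minus_commute)
  have "cmod u \<le> cmod w"
  proof (cases "cmod w \<le> 1")
    case True
    then have "w \<in> U" using w lattice_gen_swap by (auto simp: U_def)
    then show ?thesis by (rule u(2))
  qed (use u(1) in \<open>auto simp: U_def\<close>)
  then have "1 \<le> cmod (w / u)" using \<open>u \<noteq> 0\<close> by (simp add: norm_divide field_simps)
  then have "1 \<le> (cmod (w / u))\<^sup>2" by (simp add: one_le_power)
  then have "1 \<le> (Re (w / u))\<^sup>2 + (Im (w / u))\<^sup>2" by (simp only: cmod_power2)
  moreover have "(Re (w / u))\<^sup>2 \<le> (1 / 2)\<^sup>2" using Re by (simp only: abs_le_square_iff[symmetric])
  ultimately have "3 / 4 \<le> (Im (w / u))\<^sup>2" by (simp add: power2_eq_square)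
  then have "sqrt (3 / 4) \<le> \<bar>Im (w / u)\<bar>" by (metis real_sqrt_abs real_sqrt_le_iff)
  then have Im: "sqrt 3 / 2 \<le> \<bar>Im (w / u)\<bar>" by (simp add: real_sqrt_divide)
  show thesis
  proof (cases "Im (w / u) \<ge> 0")
    case True then show ?thesis using that[OF w \<open>u \<noteq> 0\<close> Re] Im by simp
  next
    case False
    then show ?thesis using that[of u "- w"] w lattice_gen_minus \<open>u \<noteq> 0\<close> Re Im by simp
  qed
qed

text \<open>
In a reduced basis the real part of \<open>v / u\<close> may have either sign, while the construction gives
nonpositive ones; for positive real part the similarity is composed with a reflection.
\<close>

theorem theorem1p1:
  fixes \<tau> :: complex
  assumes "Im \<tau> > 0"
  shows "\<exists>(\<Lambda> :: complex set) (f :: complex set \<Rightarrow> real^3).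
           is_lattice \<Lambda> \<and> has_modulus \<Lambda> \<tau> \<and> origami_embedding \<Lambda> f"
proof -
  obtain u v where uv: "lattice_gen u v = lattice_gen 1 \<tau>" "u \<noteq> 0"
    "\<bar>Re (v / u)\<bar> \<le> 1 / 2" "Im (v / u) \<ge> sqrt 3 / 2"
    using reduced_basis[OF assms] by blast
  define \<sigma> where "\<sigma> = v / u"
  have v: "v = u * \<sigma>" using uv(2) by (simp add: \<sigma>_def)
  define c where "c = 72 * sin gon36.\<mu>"
  have c: "c > 0" using gon36.mu_trig by (simp add: c_def)
  define w where "w = Complex (- (c * \<bar>Re \<sigma>\<bar>)) (c * Im \<sigma>)"
  define \<Lambda> where "\<Lambda> = lattice_gen (of_real c) w"
  have "0 < sqrt 3 / 2" by simp
  also have "\<dots> \<le> Im \<sigma>" using uv(4) by (simp only: \<sigma>_def)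
  finally have Im: "Im \<sigma> > 0" .
  have "\<exists>f. origami_embedding \<Lambda> f"
    unfolding \<Lambda>_def w_def c_def
  proof (rule origami_reduced)
    show "72 * sin gon36.\<mu> * \<bar>Re \<sigma>\<bar> \<le> 72 * sin gon36.\<mu> / 2"
      using uv(3) c by (simp add: \<sigma>_def c_def)
    show "sqrt 3 / 2 * (72 * sin gon36.\<mu>) \<le> 72 * sin gon36.\<mu> * Im \<sigma>"
      using uv(4) c by (simp add: \<sigma>_def c_def mult.commute)
  qed (use c in \<open>simp add: c_def\<close>)
  moreover have lattice: "is_lattice \<Lambda>"
  proof -
    have nz: "complex_of_real c \<noteq> 0" "Im w \<noteq> 0" using c Im by (auto simp: w_def)
    then have "w \<notin> span {of_real c}" by (auto simp: span_singleton)
    then have "independent {w, of_real c}" using nz by (simp add: independent_insert)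
    moreover have "of_real c \<noteq> w" using nz by auto
    ultimately show ?thesis unfolding is_lattice_def \<Lambda>_def by (metis insert_commute)
  qed
  moreover have "has_modulus \<Lambda> \<tau>"
  proof (cases "Re \<sigma> \<le> 0")
    case True
    let ?h = "\<lambda>z. (u / of_real c) * z"
    have "linear ?h"
      by (rule linearI) (simp_all only: distrib_left complex_cnj_add complex_cnj_scaleR mult_scaleR_right)
    moreover have "w = of_real c * \<sigma>" using True by (simp add: w_def complex_eq_iff)
    then have "?h (of_real c) = u" "?h w = v" using c by (simp_all add: v)
    ultimately have "?h ` \<Lambda> = lattice_gen 1 \<tau>"
      unfolding \<Lambda>_def using image_lattice_gen[of ?h] uv(1) by simp
    then show ?thesis
      using \<open>linear ?h\<close> c uv(2) assms lattice
      by (intro has_modulus_of_linear_similarity[where h = ?h and k = "cmod u / c"])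
        (auto simp: norm_mult norm_divide)
  next
    case False
    let ?h = "\<lambda>z. - (u / of_real c) * cnj z"
    have "linear ?h"
      by (rule linearI) (simp_all only: distrib_left complex_cnj_add complex_cnj_scaleR mult_scaleR_right)
    moreover have "cnj w = - of_real c * \<sigma>" using False by (simp add: w_def complex_eq_iff)
    then have "?h (of_real c) = - u" "?h w = v" using c by (simp_all add: v)
    ultimately have "?h ` \<Lambda> = lattice_gen (- u) v"
      unfolding \<Lambda>_def using image_lattice_gen[of ?h] by simp
    also have "\<dots> = lattice_gen 1 \<tau>"
      using uv(1) lattice_gen_minus lattice_gen_swap by metis
    finally show ?thesis
      using \<open>linear ?h\<close> c uv(2) assms lattice
      by (intro has_modulus_of_linear_similarity[where h = ?h and k = "cmod u / c"])
        (auto simp: norm_mult norm_divide)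
  qed
  ultimately show ?thesis by blast
qed

end
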